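(* The Anderson-Thakur function $\omega(t)$ is hypertranscendental over $\bar{K}(t)$, i.e. the set $\{\partial_t^{(n)}(\omega) \mid n\geq 0\}$ is algebraically independent over $\bar{K}(t)$ (meaning that the family $(\partial_t^{(n)}(\omega))_{n\ge 0}$ is algebraically independent).
   Context: Let $\mathbb{F}_q$ be the finite field with $q$ elements and $K=\mathbb{F}_q(\theta)$, with absolute value $|\cdot|_\infty$ normalized by $|\theta|_\infty=q$. $K_\infty$ is the completion of $K$, $\mathbb{C}_\infty$ is the completion of an algebraic closure of $K_\infty$, and $\bar K$ is the algebraic closure of $K$ inside $\mathbb{C}_\infty$. All functions are viewed inside the field of Laurent series $\mathbb{C}_\infty((t))$. Let $\lambda_\theta\in\bar K$ be a $(q-1)$-th root of $-\theta$ and \[ \Omega(t)= \lambda_\theta^{-q} \prod_{j \geq 1} \Big(1 - \frac{t}{\theta^{q^j}}\Big). \] The Anderson-Thakur function is $\omega(t)=\frac{1}{(t-\theta)\,\Omega(t)}\in\mathbb{C}_\infty[[t]]$ (it converges on $|t|_\infty\le 1$). The hyperdifferential operators with respect to $t$ are the $\mathbb{C}_\infty$-linear maps $\partial_t^{(n)}$, $n\ge0$, on $\mathbb{C}_\infty((t))$ given by $\partial_t^{(n)}\big(\sum_{i\ge i_0} x_it^i\big)=\sum_{i\ge i_0}\binom{i}{n}x_it^{i-n}$, with $\binom{i}{n}$ reduced modulo the characteristic. *)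

theory Defs
  imports
    "HOL-Analysis.Analysis"
    "HOL-Computational_Algebra.Formal_Laurent_Series"
    "HOL-Library.Poly_Mapping"
begin

section \<open>Fields with a non-archimedean absolute value\<close>

text \<open>
  The class of real normed fields of the library has characteristic zero, so it does not apply here.
  The metric is the one induced by the absolute value; hence the library notions of limit,
  closure and completeness (class \<^class>\<open>complete_space\<close>) refer to it. That the absolute value is
  nonnegative and vanishes only at zero follows from the metric axioms.
\<close>

class nonarch_valued_field = field + metric_space +
  fixes absv :: "'a \<Rightarrow> real"
  assumes dist_absv: "dist x y = absv (x - y)"
    and nav_mult: "absv (x * y) = absv x * absv y"
    and nav_ultrametric: "absv (x + y) \<le> max (absv x) (absv y)"

lemma nav_nonneg:
  fixes x :: "'a::nonarch_valued_field"
  shows "0 \<le> absv x"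
  using dist_absv[of x 0] zero_le_dist[of x 0] by simp

lemma nav_eq_zero:
  fixes x :: "'a::nonarch_valued_field"
  shows "absv x = 0 \<longleftrightarrow> x = 0"
  using dist_absv[of x 0] dist_eq_0_iff[of x 0] by simp

lemma nav_one: "absv (1 :: 'a::nonarch_valued_field) = 1"
proof -
  have "absv (1::'a) * absv (1::'a) = absv (1::'a)" using nav_mult[of "1::'a" 1] by simp
  moreover have "absv (1::'a) \<noteq> 0" by (simp add: nav_eq_zero)
  ultimately show ?thesis by simp
qed

lemma nav_uminus:
  fixes x :: "'a::nonarch_valued_field"
  shows "absv (- x) = absv x"
proof -
  have "absv (- 1 :: 'a) * absv (- 1 :: 'a) = 1"
    using nav_mult[of "- 1 :: 'a" "- 1"] nav_one[where 'a = 'a] by simp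
  then have "absv (- 1 :: 'a) = 1 \<or> absv (- 1 :: 'a) = - 1"
    by (simp only: square_eq_1_iff)
  then have "absv (- 1 :: 'a) = 1"
    using nav_nonneg[of "- 1 :: 'a"] by linarith
  then show ?thesis using nav_mult[of "- 1" x] by simp
qed

lemma nav_diff_le:
  fixes x :: "'a::nonarch_valued_field"
  shows "absv (x - y) \<le> max (absv x) (absv y)"
  using nav_ultrametric[of x "- y"] by (simp add: nav_uminus)

section \<open>Subfields, algebraic elements, algebraic independence\<close>

definition is_subfield :: "'a::field set \<Rightarrow> bool" where
  "is_subfield F \<longleftrightarrow> 0 \<in> F \<and> 1 \<in> F \<and>
     (\<forall>x\<in>F. \<forall>y\<in>F. x - y \<in> F \<and> x * y \<in> F) \<and> (\<forall>x\<in>F. inverse x \<in> F)"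

definition adjoin :: "'a::field set \<Rightarrow> 'a \<Rightarrow> 'a set" where
  "adjoin F a = is_subfield hull (insert a F)"

definition algebraic_over :: "'a::field set \<Rightarrow> 'a \<Rightarrow> bool" where
  "algebraic_over F x \<longleftrightarrow> (\<exists>p. p \<noteq> 0 \<and> (\<forall>i. coeff p i \<in> F) \<and> poly p x = 0)"

definition is_algebraic_closure :: "'a::field set \<Rightarrow> 'a set \<Rightarrow> bool" where
  "is_algebraic_closure F L \<longleftrightarrow>
     is_subfield F \<and> is_subfield L \<and> F \<subseteq> L \<and> (\<forall>x\<in>L. algebraic_over F x) \<and>
     (\<forall>p. degree p > 0 \<and> (\<forall>i. coeff p i \<in> L) \<longrightarrow> (\<exists>x\<in>L. poly p x = 0))"

text \<open>
  A polynomial in variables indexed by \<open>'i\<close> is a finitely supported map from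
  exponent vectors (themselves finitely supported) to coefficients.
\<close>

definition mpoly_value :: "('i \<Rightarrow> 'a::comm_semiring_1) \<Rightarrow> (('i \<Rightarrow>\<^sub>0 nat) \<Rightarrow>\<^sub>0 'a) \<Rightarrow> 'a" where
  "mpoly_value x P =
     (\<Sum>m\<in>Poly_Mapping.keys P.
        Poly_Mapping.lookup P m * (\<Prod>i\<in>Poly_Mapping.keys m. x i ^ Poly_Mapping.lookup m i))"

definition alg_independent :: "'a::field set \<Rightarrow> ('i \<Rightarrow> 'a) \<Rightarrow> bool" where
  "alg_independent F x \<longleftrightarrow>
     (\<forall>P. (\<forall>m. Poly_Mapping.lookup P m \<in> F) \<and> mpoly_value x P = 0 \<longrightarrow> P = 0)"

section \<open>The field \<open>\<complex>\<^sub>\<infinity>\<close>\<close>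

text \<open>
  \<open>\<F>\<^sub>q\<close> is a finite subfield \<open>Fq\<close> of the ambient valued field, \<open>q = card Fq\<close>.
  Nonzero elements of \<open>Fq\<close> are roots of unity, so they have absolute value \<open>1\<close>; hence
  \<open>absv \<theta> = q > 1\<close> forces \<open>\<theta>\<close> to be transcendental over \<open>Fq\<close> and the absolute value on
  \<open>Fq(\<theta>)\<close> to be the one at the infinite place.
\<close>

definition rat_K :: "'c::nonarch_valued_field set \<Rightarrow> 'c \<Rightarrow> 'c set" where
  "rat_K Fq \<theta> = adjoin Fq \<theta>"

text \<open>The completion of a subfield of a complete valued field is its topological closure.\<close>

definition K_inf :: "'c::{nonarch_valued_field, complete_space} set \<Rightarrow> 'c \<Rightarrow> 'c set" where
  "K_inf Fq \<theta> = closure (rat_K Fq \<theta>)"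

definition K_bar :: "'c::nonarch_valued_field set \<Rightarrow> 'c \<Rightarrow> 'c set" where
  "K_bar Fq \<theta> = {x. algebraic_over (rat_K Fq \<theta>) x}"

text \<open>
  The type \<open>'c\<close> is \<open>\<complex>\<^sub>\<infinity>\<close>: it is complete and contains an algebraic closure of \<open>K\<^sub>\<infinity>\<close> as a dense
  subfield, i.e. it is the completion of that algebraic closure. This determines it up to
  isometric isomorphism, since the absolute value of the complete field \<open>K\<^sub>\<infinity>\<close> extends
  uniquely to algebraic extensions.
\<close>

definition is_C_inf :: "'c::{nonarch_valued_field, complete_space} set \<Rightarrow> 'c \<Rightarrow> bool" where
  "is_C_inf Fq \<theta> \<longleftrightarrow>
     finite Fq \<and> is_subfield Fq \<and> absv \<theta> = real (card Fq) \<and>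
     (\<exists>L. is_algebraic_closure (K_inf Fq \<theta>) L \<and> closure L = UNIV)"

section \<open>The Anderson-Thakur function\<close>

text \<open>
  The topology the library puts on formal power series is the \<open>t\<close>-adic one, in which the
  product for \<open>\<Omega>\<close> does not converge. The product is taken coefficientwise
  with respect to the absolute value.
\<close>

definition Omega_partial :: "nat \<Rightarrow> 'c::nonarch_valued_field \<Rightarrow> nat \<Rightarrow> 'c fps" where
  "Omega_partial q \<theta> N = (\<Prod>j=1..N. 1 - fps_const (inverse (\<theta> ^ (q ^ j))) * fps_X)"

definition Omega :: "nat \<Rightarrow> 'c::nonarch_valued_field \<Rightarrow> 'c \<Rightarrow> 'c fps" where
  "Omega q \<theta> lam =
     fps_const (inverse (lam ^ q)) * Abs_fps (\<lambda>n. lim (\<lambda>N. fps_nth (Omega_partial q \<theta> N) n))"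

definition anderson_thakur :: "nat \<Rightarrow> 'c::nonarch_valued_field \<Rightarrow> 'c \<Rightarrow> 'c fls" where
  "anderson_thakur q \<theta> lam = 1 / ((fls_X - fls_const \<theta>) * fps_to_fls (Omega q \<theta> lam))"

text \<open>The limits in \<^const>\<open>Omega\<close> exist.\<close>

lemma fps_nth_linear_mult:
  fixes f :: "'c::nonarch_valued_field fps"
  shows "fps_nth (f * (1 - fps_const a * fps_X)) n
           = fps_nth f n - (if n = 0 then 0 else a * fps_nth f (n - 1))"
proof -
  have "f * (1 - fps_const a * fps_X) = f - fps_const a * (f * fps_X)"
    by (simp add: algebra_simps)
  then show ?thesis by simp
qed

lemma Omega_partial_Suc:
  "Omega_partial q \<theta> (Suc N)
     = Omega_partial q \<theta> N * (1 - fps_const (inverse (\<theta> ^ (q ^ Suc N))) * fps_X)"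
  by (simp add: Omega_partial_def del: power_Suc)

lemma nav_inverse_power:
  fixes x :: "'c::nonarch_valued_field"
  shows "absv (inverse (x ^ k)) = inverse (absv x) ^ k"
proof (cases "x = 0")
  case True
  then show ?thesis by (cases k) (simp_all add: nav_one nav_eq_zero[THEN iffD2])
next
  case False
  have "absv (inverse x) * absv x = 1"
    using False by (simp add: nav_mult[symmetric] nav_one)
  then have 1: "absv (inverse x) = inverse (absv x)"
    by (metis inverse_unique mult.commute)
  have "absv (y ^ k) = absv y ^ k" for y :: 'c
    by (induction k) (simp_all add: nav_one nav_mult)
  then show ?thesis by (simp only: power_inverse[symmetric] 1)
qed

lemma absv_nth_Omega_partial:
  fixes \<theta> :: "'c::nonarch_valued_field"
  assumes "absv \<theta> > 1"
  shows "absv (fps_nth (Omega_partial q \<theta> N) n) \<le> 1"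
proof (induction N arbitrary: n)
  case 0
  show ?case by (cases n) (auto simp: Omega_partial_def nav_one nav_eq_zero[THEN iffD2])
next
  case (Suc N)
  let ?P = "Omega_partial q \<theta> N" and ?a = "inverse (\<theta> ^ (q ^ Suc N))"
  have a: "absv ?a \<le> 1"
    using assms by (simp add: nav_inverse_power power_le_one inverse_le_1_iff)
  have "absv (fps_nth ?P n - (if n = 0 then 0 else ?a * fps_nth ?P (n - 1)))
          \<le> max (absv (fps_nth ?P n)) (absv (if n = 0 then 0 else ?a * fps_nth ?P (n - 1)))"
    by (rule nav_diff_le)
  also have "\<dots> \<le> 1"
    using Suc.IH[of n] mult_mono[OF a Suc.IH[of "n - 1"]]
    by (simp add: nav_mult nav_nonneg nav_eq_zero[THEN iffD2] del: power_Suc)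
  finally show ?case
    unfolding Omega_partial_Suc fps_nth_linear_mult .
qed

lemma convergent_nth_Omega_partial:
  fixes \<theta> :: "'c::{nonarch_valued_field, complete_space}"
  assumes "absv \<theta> > 1" "q > 1"
  shows "convergent (\<lambda>N. fps_nth (Omega_partial q \<theta> N) n)"
proof (rule Cauchy_convergent, rule metric_CauchyI)
  fix e :: real
  assume "e > 0"
  let ?c = "\<lambda>N. fps_nth (Omega_partial q \<theta> N) n"
  define r where "r = inverse (absv \<theta>)"
  have r: "0 < r" "r < 1" using assms by (auto simp: r_def inverse_less_1_iff)
  obtain M where M: "r ^ M < e"
    using real_arch_pow_inv[OF \<open>e > 0\<close> r(2)] by blast
  have step: "dist (?c (Suc N)) (?c N) \<le> r ^ N" for N
  proof -
    let ?b = "fps_nth (Omega_partial q \<theta> N) (n - 1)" and ?a = "inverse (\<theta> ^ (q ^ Suc N))"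
    have "N \<le> q ^ Suc N"
      using less_exp[of N] power_mono[of 2 q N] power_increasing[of N "Suc N" q] assms(2)
      by linarith
    then have "absv ?a \<le> r ^ N"
      using r by (simp add: nav_inverse_power r_def[symmetric] power_decreasing del: power_Suc)
    then have "absv ?a * absv ?b \<le> r ^ N * 1"
      using absv_nth_Omega_partial[OF assms(1)] r by (intro mult_mono) (auto simp: nav_nonneg)
    then show ?thesis
      using r unfolding dist_absv Omega_partial_Suc fps_nth_linear_mult
      by (simp add: nav_uminus nav_mult nav_eq_zero[THEN iffD2] del: power_Suc)
  qed
  have le: "dist (?c (M + k)) (?c M) \<le> r ^ M" for k
  proof (induction k)
    case 0
    show ?case using r by simp
  next
    case (Suc k)
    have "dist (?c (Suc (M + k))) (?c M)
            \<le> max (dist (?c (Suc (M + k))) (?c (M + k))) (dist (?c (M + k)) (?c M))"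
      unfolding dist_absv
      using nav_ultrametric[of "?c (Suc (M + k)) - ?c (M + k)" "?c (M + k) - ?c M"]
      by (simp only: diff_add_cancel add_diff_eq)
    also have "\<dots> \<le> r ^ M"
      using step[of "M + k"] Suc.IH power_decreasing[of M "M + k" r] r by (simp del: power_decreasing_iff)
    finally show ?case by simp
  qed
  have "dist (?c m) (?c k) < e" if "M \<le> m" "M \<le> k" for m k
  proof -
    have "dist (?c m) (?c k) \<le> max (dist (?c m) (?c M)) (dist (?c k) (?c M))"
      unfolding dist_absv
      using nav_diff_le[of "?c m - ?c M" "?c k - ?c M"] by simp
    then show ?thesis
      using le[of "m - M"] le[of "k - M"] that M by auto
  qed
  then show "\<exists>M. \<forall>m\<ge>M. \<forall>k\<ge>M. dist (?c m) (?c k) < e" by blast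
qed

section \<open>Hyperdifferential operators\<close>

text \<open>
  The integer \<open>i choose n\<close> for a possibly negative upper index. The constant of the library for
  generalized binomial coefficients is constrained here to fields of characteristic zero, with which
  this definition agrees; in particular the division is exact.
\<close>

definition binom_int :: "int \<Rightarrow> nat \<Rightarrow> int" where
  "binom_int i n = (\<Prod>k=0..<n. i - int k) div fact n"

lemma of_int_binom_int: "of_int (binom_int i n) = (of_int i gchoose n :: 'a::field_char_0)"
proof -
  have "fact n dvd (\<Prod>k=0..<n. i - int k)"
    using fact_dvd_pochhammer[of n "i - int n + 1"] falling_fact_pochhammer'[of i n] by simp
  then have "fact n * binom_int i n = (\<Prod>k=0..<n. i - int k)"
    by (simp add: binom_int_def)
  then have "of_int (fact n * binom_int i n) = (of_int (\<Prod>k=0..<n. i - int k) :: 'a)"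
    by (rule arg_cong)
  then have "fact n * of_int (binom_int i n) = (fact n * (of_int i gchoose n) :: 'a)"
    by (simp add: gbinomial_mult_fact)
  then show ?thesis by simp
qed

text \<open>The map \<open>of_int\<close> reduces the binomial coefficient modulo the characteristic.\<close>

definition hyperderiv :: "nat \<Rightarrow> 'c::field fls \<Rightarrow> 'c fls" where
  "hyperderiv n f = Abs_fls (\<lambda>i. of_int (binom_int (i + int n) n) * fls_nth f (i + int n))"

lemma fls_nth_hyperderiv:
  "fls_nth (hyperderiv n f) i = of_int (binom_int (i + int n) n) * fls_nth f (i + int n)"
  unfolding hyperderiv_def
  by (rule nth_Abs_fls_lower_bound[where N = "fls_subdegree f - int n"]) auto

text \<open>The field \<open>F(t)\<close> inside \<open>\<complex>\<^sub>\<infinity>((t))\<close>, for a subfield \<open>F\<close> of \<open>\<complex>\<^sub>\<infinity>\<close>.\<close>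

definition ratfun_field :: "'c::field set \<Rightarrow> 'c fls set" where
  "ratfun_field F = adjoin (fls_const ` F) fls_X"

end

theory Submission
  imports Defs
begin

text \<open>
  The coefficients \<open>w 0, w 1, \<dots>\<close> of the Anderson-Thakur function
  \<open>\<omega>\<close> are torsion points of the Carlitz module. Indeed the product formula for
  \<open>\<Omega>\<close> gives the difference equation
  \<open>twist \<omega> = (t - \<theta>) * \<omega>\<close>, where \<open>twist\<close> raises the
  coefficients to the \<open>q\<close>-th power (\<open>anderson_thakur_coefficients\<close>), and
  this says \<open>w 0 ^ (q - 1) = - \<theta>\<close> and
  \<open>w (n + 1) ^ q + \<theta> * w (n + 1) = w n\<close>. If \<open>a\<close> is a power series
  with coefficients in \<open>\<F>\<^sub>q\<close> and nonzero constant coefficient, then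
  \<open>a * \<omega>\<close> satisfies the same equation, so its coefficients form another such
  system of torsion points.

  The fields generated over \<open>K = \<F>\<^sub>q(\<theta>)\<close> by the torsion points
  \<open>w 0, \<dots>, w n\<close> are totally ramified above the prime \<open>\<theta>\<close>.
  Therefore the equations above have the least possible degree, and there is a homomorphism over
  \<open>K\<close> that sends the coefficients of \<open>\<omega>\<close> to those of
  \<open>a * \<omega>\<close> (\<open>torsion_partial_hom\<close>). It extends to the algebraic
  closure \<open>K_bar\<close> of \<open>K\<close> (\<open>partial_hom_extend_algebraic\<close>). The
  valuation ring needed for the ramification argument is obtained as a maximal subring that contains
  \<open>\<F>\<^sub>q[\<theta>]\<close> but not \<open>inverse \<theta>\<close>
  (\<open>valuation_ring_exists\<close>).

  Now let \<open>P\<close> be a nonzero polynomial over \<open>K_bar(t)\<close> that vanishes at the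
  hyperderivatives of \<open>\<omega>\<close>. The homomorphism just described commutes with
  hyperderivatives, so it turns \<open>P\<close> into a polynomial that vanishes at the
  hyperderivatives of \<open>a * \<omega>\<close>. As \<open>a\<close> varies, only finitely many
  polynomials arise in this way, since each coefficient of \<open>P\<close> has finitely many
  conjugates over \<open>K(t)\<close> (\<open>ratfun_finitely_many_conjugates\<close>). On the other
  hand, write \<open>a = (\<Sum>i<n. b i * t ^ i)\<close> with each \<open>b i\<close> of the form
  \<open>1 + t ^ N\<close>, where \<open>N\<close> is sufficiently divisible. The first
  hyperderivatives treat such \<open>b i\<close> as constants, and those of
  \<open>a * \<omega>\<close> of order less than \<open>n\<close> are obtained from the tuple
  \<open>b\<close> by an invertible linear map. The \<open>b i\<close> can be chosen independently
  from an infinite set, so the resulting points are Zariski dense and do not lie in the union of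
  finitely many hypersurfaces (\<open>multiplier_avoiding_relations\<close>). This contradiction
  proves the theorem.
\<close>

section \<open>Homomorphisms between subfields\<close>

text \<open>
  A field homomorphism defined on a subfield is encoded as its graph, a subset of
  \<open>'a \<times> 'a\<close>. The closure conditions make the domain a subfield without mentioning
  it, homomorphisms are ordered by inclusion, and the union of a chain is again a homomorphism, which
  is what Zorn's lemma requires.
\<close>

definition partial_hom :: "('a::field \<times> 'a) set \<Rightarrow> bool" where
  "partial_hom r \<longleftrightarrow> (0, 0) \<in> r \<and> (1, 1) \<in> r \<and>
     (\<forall>(x, x')\<in>r. \<forall>(y, y')\<in>r. (x - y, x' - y') \<in> r \<and> (x * y, x' * y') \<in> r) \<and>
     (\<forall>(x, x')\<in>r. (inverse x, inverse x') \<in> r) \<and> (\<forall>y. (0, y) \<in> r \<longrightarrow> y = 0)"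

context
  fixes r :: "('a::field \<times> 'a) set"
  assumes r: "partial_hom r"
begin

lemma partial_hom_zero: "(0, 0) \<in> r"
  and partial_hom_one: "(1, 1) \<in> r"
  and partial_hom_diff: "(x, x') \<in> r \<Longrightarrow> (y, y') \<in> r \<Longrightarrow> (x - y, x' - y') \<in> r"
  and partial_hom_mult: "(x, x') \<in> r \<Longrightarrow> (y, y') \<in> r \<Longrightarrow> (x * y, x' * y') \<in> r"
  and partial_hom_inverse: "(x, x') \<in> r \<Longrightarrow> (inverse x, inverse x') \<in> r"
  and partial_hom_zeroD: "(0, y) \<in> r \<Longrightarrow> y = 0"
  using r unfolding partial_hom_def by auto

lemma partial_hom_uminus: "(x, x') \<in> r \<Longrightarrow> (- x, - x') \<in> r"
  using partial_hom_diff[OF partial_hom_zero] by simp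

lemma partial_hom_add: "(x, x') \<in> r \<Longrightarrow> (y, y') \<in> r \<Longrightarrow> (x + y, x' + y') \<in> r"
  using partial_hom_diff[of x x' "- y" "- y'"] partial_hom_uminus[of y y'] by simp

lemma partial_hom_power: "(x, x') \<in> r \<Longrightarrow> (x ^ n, x' ^ n) \<in> r"
  by (induction n) (auto intro: partial_hom_one partial_hom_mult)

lemma partial_hom_sum: "(\<And>i. i \<in> I \<Longrightarrow> (f i, g i) \<in> r) \<Longrightarrow> (sum f I, sum g I) \<in> r"
  by (induction I rule: infinite_finite_induct) (auto intro: partial_hom_zero partial_hom_add)

lemma partial_hom_of_nat: "(of_nat n, of_nat n) \<in> r"
  by (induction n) (auto intro: partial_hom_zero partial_hom_one partial_hom_add)

lemma partial_hom_of_int: "(of_int n, of_int n) \<in> r"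
  by (cases n rule: int_diff_cases) (auto intro: partial_hom_of_nat partial_hom_diff)

lemma partial_hom_unique:
  assumes "(x, y) \<in> r" "(x, z) \<in> r"
  shows "y = z"
  using partial_hom_zeroD[of "y - z"] partial_hom_diff[OF assms] by simp

text \<open>
  Homomorphisms of fields are injective: from \<open>(x, 0) \<in> r\<close> with
  \<open>x \<noteq> 0\<close> multiplication by the inverse gives \<open>(1, 0) \<in> r\<close>.
\<close>

lemma partial_hom_eq_0_iff:
  assumes "(x, y) \<in> r"
  shows "x = 0 \<longleftrightarrow> y = 0"
proof (cases "x = 0")
  case False
  have "(x * inverse x, y * inverse y) \<in> r"
    using assms by (intro partial_hom_mult partial_hom_inverse)
  then show ?thesis
    using False partial_hom_unique[OF _ partial_hom_one, of 0] by auto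
qed (use assms partial_hom_zeroD in auto)

end

definition polrel :: "('a::field \<times> 'a) set \<Rightarrow> 'a poly \<Rightarrow> 'a poly \<Rightarrow> bool" where
  "polrel r p p' \<longleftrightarrow> (\<forall>i. (coeff p i, coeff p' i) \<in> r)"

text \<open>
  The extension of the homomorphism to \<open>K[\<alpha>]\<close> that sends \<open>\<alpha>\<close>
  to \<open>\<beta>\<close>, where \<open>K\<close> is its domain.
\<close>

definition adjoin_root :: "('a::field \<times> 'a) set \<Rightarrow> 'a \<Rightarrow> 'a \<Rightarrow> ('a \<times> 'a) set" where
  "adjoin_root r \<alpha> \<beta> = {(poly p \<alpha>, poly p' \<beta>) | p p'. polrel r p p'}"

context
  fixes r :: "('a::field \<times> 'a) set"
  assumes r: "partial_hom r"
begin

lemma polrel_diff: "polrel r p p' \<Longrightarrow> polrel r s s' \<Longrightarrow> polrel r (p - s) (p' - s')"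
  by (auto simp: polrel_def intro: partial_hom_diff[OF r])

lemma polrel_add: "polrel r p p' \<Longrightarrow> polrel r s s' \<Longrightarrow> polrel r (p + s) (p' + s')"
  by (auto simp: polrel_def intro: partial_hom_add[OF r])

lemma polrel_mult: "polrel r p p' \<Longrightarrow> polrel r s s' \<Longrightarrow> polrel r (p * s) (p' * s')"
  by (auto simp: polrel_def coeff_mult intro!: partial_hom_sum[OF r] partial_hom_mult[OF r])

lemma polrel_zero: "polrel r 0 0"
  by (auto simp: polrel_def partial_hom_zero[OF r])

lemma polrel_monom: "(c, c') \<in> r \<Longrightarrow> polrel r (monom c n) (monom c' n)"
  by (auto simp: polrel_def partial_hom_zero[OF r])

lemma polrel_const: "(c, c') \<in> r \<Longrightarrow> polrel r [:c:] [:c':]"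
  using polrel_monom[of c c' 0] by (simp add: monom_0)

lemma polrel_one: "polrel r 1 1"
  using polrel_const[OF partial_hom_one[OF r]] by (simp add: one_pCons)

lemma polrel_eq_0_iff: "polrel r p p' \<Longrightarrow> p = 0 \<longleftrightarrow> p' = 0"
  using partial_hom_eq_0_iff[OF r] by (auto simp: polrel_def poly_eq_iff)

lemma polrel_degree: "polrel r p p' \<Longrightarrow> degree p = degree p'"
proof -
  assume "polrel r p p'"
  then have "coeff p i = 0 \<longleftrightarrow> coeff p' i = 0" for i
    using partial_hom_eq_0_iff[OF r] by (simp add: polrel_def)
  then show "degree p = degree p'"
    by (intro antisym degree_le) (simp_all add: coeff_eq_0, metis coeff_eq_0)
qed

lemma polrel_poly:
  assumes "polrel r p p'" "(x, x') \<in> r"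
  shows "(poly p x, poly p' x') \<in> r"
  using assms unfolding poly_altdef polrel_degree[OF assms(1)]
  by (intro partial_hom_sum[OF r] partial_hom_mult[OF r] partial_hom_power[OF r])
     (auto simp: polrel_def)

text \<open>
  Division with remainder uses only field operations on coefficients, so it commutes with
  homomorphisms.
\<close>

lemma polrel_divide:
  assumes f: "polrel r f f'" "f \<noteq> 0" and "polrel r g g'"
  shows "\<exists>h h' s s'. polrel r h h' \<and> polrel r s s' \<and> g = f * h + s \<and> g' = f' * h' + s'
           \<and> (s = 0 \<or> degree s < degree f)"
  using assms(3)
proof (induction "degree g" arbitrary: g g' rule: less_induct)
  case less
  show ?case
  proof (cases "g = 0 \<or> degree g < degree f")
    case True
    then show ?thesis
      using less.prems polrel_zero by (intro exI[of _ 0] exI[of _ g] exI[of _ g']) auto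
  next
    case False
    let ?c = "lead_coeff g * inverse (lead_coeff f)" and ?k = "degree g - degree f"
    let ?c' = "lead_coeff g' * inverse (lead_coeff f')"
    let ?m = "monom ?c ?k" and ?m' = "monom ?c' ?k"
    have c: "(?c, ?c') \<in> r"
      using f(1) less.prems
      by (intro partial_hom_mult[OF r] partial_hom_inverse[OF r])
         (simp_all add: polrel_degree[OF f(1), symmetric] polrel_degree[OF less.prems, symmetric],
          simp_all add: polrel_def)
    let ?g = "g - f * ?m" and ?g' = "g' - f' * ?m'"
    have rel: "polrel r ?g ?g'"
      by (intro polrel_diff polrel_mult polrel_monom c f less.prems)
    have "degree (f * ?m) \<le> degree g"
      using False degree_mult_le[of f ?m] degree_monom_le[of ?c ?k] by linarith
    then have "degree ?g \<le> degree g" by (simp add: degree_diff_le)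
    moreover have "coeff ?g (degree g) = 0"
      using False f(2) by (simp add: coeff_monom_mult mult.commute[of f])
    ultimately have "?g = 0 \<or> degree ?g < degree g"
      by (rule eq_zero_or_degree_less)
    moreover have "\<exists>h h' s s'. polrel r h h' \<and> polrel r s s' \<and> ?g = f * h + s \<and>
        ?g' = f' * h' + s' \<and> (s = 0 \<or> degree s < degree f)" if "?g = 0"
    proof -
      have "?g' = 0" using that polrel_eq_0_iff[OF rel] by blast
      then show ?thesis using that polrel_zero by (intro exI[of _ 0]) simp
    qed
    ultimately obtain h h' s s' where "polrel r h h'" "polrel r s s'" "?g = f * h + s"
      "?g' = f' * h' + s'" "s = 0 \<or> degree s < degree f"
      using less.hyps[OF _ rel] by blast
    then show ?thesis
      by (intro exI[of _ "h + ?m"] exI[of _ "h' + ?m'"] exI[of _ s] exI[of _ s'])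
         (auto intro!: polrel_add polrel_monom c simp: algebra_simps)
  qed
qed

lemma adjoin_root_mono: "r \<subseteq> adjoin_root r \<alpha> \<beta>"
proof
  fix z assume "z \<in> r"
  then show "z \<in> adjoin_root r \<alpha> \<beta>"
    using polrel_const[of "fst z" "snd z"] unfolding adjoin_root_def
    by (intro CollectI exI[of _ "[:fst z:]"] exI[of _ "[:snd z:]"]) auto
qed

lemma adjoin_root_generator: "(\<alpha>, \<beta>) \<in> adjoin_root r \<alpha> \<beta>"
  unfolding adjoin_root_def using polrel_monom[OF partial_hom_one[OF r], of 1]
  by (intro CollectI exI[of _ "monom 1 1"]) (simp add: poly_monom)

text \<open>
  If \<open>f\<close> has minimal degree among the polynomials over the domain that annihilate
  \<open>\<alpha>\<close>, then \<open>\<alpha>\<close> may be sent to any root of the image of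
  \<open>f\<close>: dividing by \<open>f\<close> shows that every relation satisfied by
  \<open>\<alpha>\<close> is satisfied by \<open>\<beta>\<close>. The values
  \<open>p(\<alpha>)\<close> already form a field; the inverse of \<open>p(\<alpha>)\<close> is found
  by the Euclidean algorithm applied to \<open>f\<close> and \<open>p\<close>, where minimality keeps
  the remainders from vanishing at \<open>\<alpha>\<close>.
\<close>

lemma partial_hom_adjoin_root:
  assumes f: "polrel r f f'" "f \<noteq> 0" "poly f \<alpha> = 0" "poly f' \<beta> = 0"
    and minimal: "\<And>p. p \<noteq> 0 \<Longrightarrow> (\<And>i. coeff p i \<in> Domain r) \<Longrightarrow> poly p \<alpha> = 0
                     \<Longrightarrow> degree f \<le> degree p"
  shows "partial_hom (adjoin_root r \<alpha> \<beta>)"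
proof -
  have dom: "coeff p i \<in> Domain r" if "polrel r p p'" for p p' i
    using that by (auto simp: polrel_def)
  have kernel: "poly p' \<beta> = 0" if p: "polrel r p p'" "poly p \<alpha> = 0" for p p'
  proof -
    obtain h h' s s' where s: "polrel r h h'" "polrel r s s'" "p = f * h + s" "p' = f' * h' + s'"
      "s = 0 \<or> degree s < degree f"
      using polrel_divide[OF f(1,2) p(1)] by blast
    have "poly s \<alpha> = 0" using p(2) s(3) f(3) by simp
    then have "s = 0"
      using minimal[of s] dom[OF s(2)] s(5) by fastforce
    then have "s' = 0" using polrel_eq_0_iff[OF s(2)] by simp
    then show ?thesis using s(4) f(4) by simp
  qed
  have inv: "\<exists>h h'. polrel r h h' \<and> poly p \<alpha> * poly h \<alpha> = 1"
    if "polrel r p p'" "poly p \<alpha> \<noteq> 0" "degree p < degree f" for p p'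
    using that
  proof (induction "degree p" arbitrary: p p' rule: less_induct)
    case less
    have p0: "p \<noteq> 0" using less.prems(2) by auto
    show ?case
    proof (cases "degree p = 0")
      case True
      then obtain c where c: "p = [:c:]" by (rule degree_eq_zeroE)
      then have "(c, coeff p' 0) \<in> r"
        using less.prems(1) by (auto simp: polrel_def dest: spec[of _ 0])
      then show ?thesis
        using less.prems(2) c
        by (intro exI[of _ "[:inverse c:]"] exI[of _ "[:inverse (coeff p' 0):]"])
           (auto intro!: polrel_const partial_hom_inverse[OF r])
    next
      case False
      obtain h h' s s' where s: "polrel r h h'" "polrel r s s'" "f = p * h + s"
        "f' = p' * h' + s'" "s = 0 \<or> degree s < degree p"
        using polrel_divide[OF less.prems(1) p0 f(1)] by blast
      have "h \<noteq> 0"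
        using s(3,5) less.prems(3) f(2) by auto
      have "degree f \<le> max (degree (p * h)) (degree s)"
        using s(3) degree_add_le_max[of "p * h" s] by simp
      then have "degree (p * h) = degree f"
        using s(3,5) less.prems(3) False degree_add_eq_left[of s "p * h"] by auto
      then have "degree h < degree f"
        using False p0 \<open>h \<noteq> 0\<close> by (simp add: degree_mult_eq)
      then have "poly h \<alpha> \<noteq> 0"
        using minimal[OF \<open>h \<noteq> 0\<close>] dom[OF s(1)] by fastforce
      have eq: "poly s \<alpha> = - (poly p \<alpha> * poly h \<alpha>)"
        using f(3) s(3) by (simp add: add_eq_0_iff)
      then have s0: "poly s \<alpha> \<noteq> 0"
        using \<open>poly h \<alpha> \<noteq> 0\<close> less.prems(2) by simp
      then have "degree s < degree p" using s(5) by auto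
      then obtain k k' where k: "polrel r k k'" "poly s \<alpha> * poly k \<alpha> = 1"
        using less.hyps[OF _ s(2) s0] less.prems(3) by fastforce
      have "polrel r (0 - h * k) (0 - h' * k')"
        by (intro polrel_diff polrel_zero polrel_mult s k)
      moreover have "poly p \<alpha> * poly (0 - h * k) \<alpha> = 1"
        using k(2) eq by (simp add: algebra_simps)
      ultimately show ?thesis by blast
    qed
  qed
  have inverse: "(inverse (poly p \<alpha>), inverse (poly p' \<beta>)) \<in> adjoin_root r \<alpha> \<beta>"
    if p: "polrel r p p'" for p p'
  proof (cases "poly p \<alpha> = 0")
    case True
    then show ?thesis
      using kernel[OF p] adjoin_root_mono[of \<alpha> \<beta>] partial_hom_zero[OF r] by auto
  next
    case False
    obtain h h' s s' where s: "polrel r h h'" "polrel r s s'" "p = f * h + s"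
      "p' = f' * h' + s'" "s = 0 \<or> degree s < degree f"
      using polrel_divide[OF f(1,2) p] by blast
    have ps: "poly p \<alpha> = poly s \<alpha>" using s(3) f(3) by simp
    then obtain k k' where k: "polrel r k k'" "poly p \<alpha> * poly k \<alpha> = 1"
      using inv[OF s(2)] s(5) False by auto
    have "poly (p' * k' - 1) \<beta> = 0"
      by (rule kernel[of "p * k - 1"]) (use k in \<open>auto intro!: polrel_diff polrel_mult p polrel_one\<close>)
    then have "inverse (poly p' \<beta>) = poly k' \<beta>"
      by (intro inverse_unique) simp
    moreover have "inverse (poly p \<alpha>) = poly k \<alpha>"
      using k(2) by (rule inverse_unique)
    ultimately show ?thesis using k(1) by (auto simp: adjoin_root_def)
  qed
  show ?thesis
    unfolding partial_hom_def
  proof (intro conjI)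
    show "(0, 0) \<in> adjoin_root r \<alpha> \<beta>" "(1, 1) \<in> adjoin_root r \<alpha> \<beta>"
      using adjoin_root_mono partial_hom_zero[OF r] partial_hom_one[OF r] by blast+
    show "\<forall>(x, x')\<in>adjoin_root r \<alpha> \<beta>. (inverse x, inverse x') \<in> adjoin_root r \<alpha> \<beta>"
      using inverse by (auto simp: adjoin_root_def[of r \<alpha> \<beta>])
    show "\<forall>y. (0, y) \<in> adjoin_root r \<alpha> \<beta> \<longrightarrow> y = 0"
      using kernel by (auto simp: adjoin_root_def)
    show "\<forall>(x, x')\<in>adjoin_root r \<alpha> \<beta>. \<forall>(y, y')\<in>adjoin_root r \<alpha> \<beta>.
        (x - y, x' - y') \<in> adjoin_root r \<alpha> \<beta> \<and> (x * y, x' * y') \<in> adjoin_root r \<alpha> \<beta>"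
    proof (clarify, goal_cases)
      case (1 x x' y y')
      obtain p p' s s' where ps: "polrel r p p'" "polrel r s s'" "x = poly p \<alpha>" "x' = poly p' \<beta>"
        "y = poly s \<alpha>" "y' = poly s' \<beta>"
        using 1 by (auto simp: adjoin_root_def)
      then show ?case
        unfolding adjoin_root_def using polrel_diff[OF ps(1,2)] polrel_mult[OF ps(1,2)]
        by (intro conjI CollectI,
            intro exI[of _ "p - s"] exI[of _ "p' - s'"], simp add: ps,
            intro exI[of _ "p * s"] exI[of _ "p' * s'"], simp add: ps)
    qed
  qed
qed

end

lemma is_subfield_hull: "is_subfield (is_subfield hull S)"
  by (rule hull_in) (auto simp: is_subfield_def)

lemma partial_hom_Id_on:
  assumes "is_subfield K"
  shows "partial_hom (Id_on K)"
  using assms by (auto simp: partial_hom_def is_subfield_def Id_on_def)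

lemma partial_hom_Union:
  assumes C: "C \<noteq> {}" "\<And>r. r \<in> C \<Longrightarrow> partial_hom r"
    and chain: "\<And>r s. r \<in> C \<Longrightarrow> s \<in> C \<Longrightarrow> r \<subseteq> s \<or> s \<subseteq> r"
  shows "partial_hom (\<Union>C)"
proof -
  have both: "\<exists>t\<in>C. z \<in> t \<and> w \<in> t" if "z \<in> \<Union>C" "w \<in> \<Union>C" for z w
    using that chain by blast
  obtain r where "r \<in> C" using C(1) by blast
  then have "(0, 0) \<in> \<Union>C" "(1, 1) \<in> \<Union>C"
    using C(2) partial_hom_zero partial_hom_one by blast+
  moreover have "(x - y, x' - y') \<in> \<Union>C \<and> (x * y, x' * y') \<in> \<Union>C"
    if "(x, x') \<in> \<Union>C" "(y, y') \<in> \<Union>C" for x x' y y'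
    using both[OF that] C(2) partial_hom_diff[of _ x x' y y'] partial_hom_mult[of _ x x' y y']
    by blast
  moreover have "(inverse x, inverse x') \<in> \<Union>C" if "(x, x') \<in> \<Union>C" for x x'
    using that C(2) partial_hom_inverse by blast
  moreover have "y = 0" if "(0, y) \<in> \<Union>C" for y
    using that C(2) partial_hom_zeroD by blast
  ultimately show ?thesis unfolding partial_hom_def by blast
qed

lemma adjoin_root_subset:
  assumes L: "is_subfield L" and "r \<subseteq> L \<times> L" "\<alpha> \<in> L" "\<beta> \<in> L"
  shows "adjoin_root r \<alpha> \<beta> \<subseteq> L \<times> L"
proof -
  have "poly p x \<in> L" if "\<And>i. coeff p i \<in> L" "x \<in> L" for p x
    using that polrel_poly[OF partial_hom_Id_on[OF L], of p p x x]
    by (auto simp: polrel_def Id_on_def)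
  then show ?thesis
    using assms unfolding adjoin_root_def polrel_def by blast
qed

text \<open>
  The field \<open>L\<close> is only assumed to contain one root of each polynomial; splitting off
  that root lowers the degree until the given root is reached.
\<close>

lemma root_in_algebraically_closed_subfield:
  assumes L: "is_subfield L"
    and closed: "\<forall>p. degree p > 0 \<and> (\<forall>i. coeff p i \<in> L) \<longrightarrow> (\<exists>x\<in>L. poly p x = 0)"
    and p: "p \<noteq> 0" "\<And>i. coeff p i \<in> L" "poly p x = 0"
  shows "x \<in> L"
  using p
proof (induction "degree p" arbitrary: p rule: less_induct)
  case less
  have r: "partial_hom (Id_on L)" using L by (rule partial_hom_Id_on)
  have rel: "polrel (Id_on L) s s' \<longleftrightarrow> s = s' \<and> (\<forall>i. coeff s i \<in> L)" for s s'
    by (auto simp: polrel_def poly_eq_iff Id_on_def)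
  have "degree p > 0"
    using less.prems by (auto intro!: Nat.gr0I elim!: degree_eq_zeroE)
  then obtain y where y: "y \<in> L" "poly p y = 0" using closed less.prems by blast
  have "coeff [:- y, 1:] i \<in> L" for i
  proof -
    have "- y \<in> L" using L y(1) unfolding is_subfield_def by (metis diff_0)
    then show ?thesis using L by (auto simp: coeff_pCons is_subfield_def split: nat.split)
  qed
  then obtain h s where h: "polrel (Id_on L) h h" "p = [:- y, 1:] * h + s"
    "s = 0 \<or> degree s < degree [:- y, 1:]"
    using polrel_divide[OF r, of "[:- y, 1:]" "[:- y, 1:]" p p] less.prems(2) rel by auto
  then have "s = 0" using y(2) by (auto elim!: degree_eq_zeroE)
  then have ph: "p = [:- y, 1:] * h" using h(2) by simp
  then have "h \<noteq> 0" using less.prems(1) by auto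
  then have deg: "degree h < degree p"
    unfolding ph by (subst degree_mult_eq) simp_all
  show ?case
  proof (cases "x = y")
    case False
    then have "poly h x = 0" using less.prems(3) unfolding ph by simp
    then show ?thesis
      using less.hyps[OF deg \<open>h \<noteq> 0\<close>] h(1) rel by blast
  qed (use y in simp)
qed

text \<open>
  Zorn's lemma applied to the homomorphisms into an algebraically closed field \<open>L\<close>. A
  maximal one is defined on every \<open>\<alpha>\<close> algebraic over \<open>K\<close>, since the
  image of a polynomial of minimal degree for \<open>\<alpha>\<close> has a root in \<open>L\<close>.
\<close>

lemma partial_hom_extend_algebraic:
  assumes L: "is_subfield L"
    and closed: "\<forall>p. degree p > 0 \<and> (\<forall>i. coeff p i \<in> L) \<longrightarrow> (\<exists>x\<in>L. poly p x = 0)"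
    and r0: "partial_hom r0" "r0 \<subseteq> L \<times> L" and K: "Id_on K \<subseteq> r0"
  shows "\<exists>r. partial_hom r \<and> r0 \<subseteq> r \<and> (\<forall>x. algebraic_over K x \<longrightarrow> x \<in> Domain r)"
proof -
  let ?A = "{r. partial_hom r \<and> r0 \<subseteq> r \<and> r \<subseteq> L \<times> L}"
  have "\<exists>M\<in>?A. \<forall>X\<in>?A. M \<subseteq> X \<longrightarrow> X = M"
  proof (rule subset_Zorn_nonempty)
    fix C assume C: "C \<noteq> {}" "subset.chain ?A C"
    then have "partial_hom (\<Union>C)"
      by (intro partial_hom_Union) (auto simp: subset_chain_def)
    then show "\<Union>C \<in> ?A" using C by (fastforce simp: subset_chain_def)
  qed (use r0 in blast)
  then obtain r where r: "partial_hom r" "r0 \<subseteq> r" "r \<subseteq> L \<times> L"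
    and maximal: "\<And>s. partial_hom s \<Longrightarrow> r \<subseteq> s \<Longrightarrow> s \<subseteq> L \<times> L \<Longrightarrow> s = r"
    by (auto dest: subset_trans)
  have "\<alpha> \<in> Domain r" if \<alpha>: "algebraic_over K \<alpha>" for \<alpha>
  proof -
    let ?P = "\<lambda>p. p \<noteq> 0 \<and> (\<forall>i. coeff p i \<in> Domain r) \<and> poly p \<alpha> = 0"
    obtain g where g: "g \<noteq> 0" "\<And>i. coeff g i \<in> K" "poly g \<alpha> = 0"
      using \<alpha> by (auto simp: algebraic_over_def)
    have KL: "K \<subseteq> Domain r" "K \<subseteq> L" using K r(2) r0(2) by auto
    then have "?P g" using g by blast
    then obtain f where f: "?P f" and minimal: "\<And>p. ?P p \<Longrightarrow> degree f \<le> degree p"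
      using ex_has_least_nat[of ?P g degree] by blast
    have "\<alpha> \<in> L"
    proof (rule root_in_algebraically_closed_subfield[OF L closed g(1) _ g(3)])
      show "coeff g i \<in> L" for i using g(2) KL(2) by blast
    qed
    obtain c where c: "\<And>i. (coeff f i, c i) \<in> r" 
      using f choice[of "\<lambda>i y. (coeff f i, y) \<in> r"] by blast
    have "c i = 0" if "i > degree f" for i
      using c[of i] that partial_hom_eq_0_iff[OF r(1)] by (auto simp: coeff_eq_0)
    then have "coeff (Abs_poly c) = c"
      by (intro coeff_Abs_poly) auto
    then have rel: "polrel r f (Abs_poly c)" using c by (simp add: polrel_def)
    have "degree f > 0" using f by (auto intro!: Nat.gr0I elim!: degree_eq_zeroE)
    moreover have "coeff (Abs_poly c) i \<in> L" for i
      using rel r(3) by (auto simp: polrel_def)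
    ultimately obtain \<beta> where \<beta>: "\<beta> \<in> L" "poly (Abs_poly c) \<beta> = 0"
      using closed[THEN spec, of "Abs_poly c"] polrel_degree[OF r(1) rel] by auto
    have "partial_hom (adjoin_root r \<alpha> \<beta>)"
      using f \<beta> rel minimal by (intro partial_hom_adjoin_root[OF r(1), of f "Abs_poly c"]) auto
    moreover have "adjoin_root r \<alpha> \<beta> \<subseteq> L \<times> L"
      using L r(3) \<open>\<alpha> \<in> L\<close> \<beta>(1) by (rule adjoin_root_subset)
    ultimately have "adjoin_root r \<alpha> \<beta> = r"
      using maximal adjoin_root_mono[OF r(1)] by blast
    then show ?thesis
      using adjoin_root_generator[OF r(1), of \<alpha> \<beta>] by blast
  qed
  then show ?thesis using r by blast
qed

section \<open>Maximal subrings as valuation rings\<close>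

definition is_subring :: "'a::comm_ring_1 set \<Rightarrow> bool" where
  "is_subring V \<longleftrightarrow> 0 \<in> V \<and> 1 \<in> V \<and> (\<forall>x\<in>V. \<forall>y\<in>V. x - y \<in> V \<and> x * y \<in> V)"

context
  fixes V :: "'a::comm_ring_1 set"
  assumes V: "is_subring V"
begin

lemma subring_zero: "0 \<in> V"
  and subring_one: "1 \<in> V"
  and subring_diff: "x \<in> V \<Longrightarrow> y \<in> V \<Longrightarrow> x - y \<in> V"
  and subring_mult: "x \<in> V \<Longrightarrow> y \<in> V \<Longrightarrow> x * y \<in> V"
  using V by (auto simp: is_subring_def)

lemma subring_uminus: "x \<in> V \<Longrightarrow> - x \<in> V"
  using subring_diff[OF subring_zero] by simp

lemma subring_add: "x \<in> V \<Longrightarrow> y \<in> V \<Longrightarrow> x + y \<in> V"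
  using subring_diff[of x "- y"] subring_uminus[of y] by simp

lemma subring_power: "x \<in> V \<Longrightarrow> x ^ n \<in> V"
  by (induction n) (auto intro: subring_one subring_mult)

lemma subring_sum: "(\<And>i. i \<in> I \<Longrightarrow> f i \<in> V) \<Longrightarrow> sum f I \<in> V"
  by (induction I rule: infinite_finite_induct) (auto intro: subring_zero subring_add)

lemma subring_poly: "(\<And>i. coeff p i \<in> V) \<Longrightarrow> x \<in> V \<Longrightarrow> poly p x \<in> V"
  unfolding poly_altdef by (intro subring_sum subring_mult subring_power)

lemma subring_coeff_mult:
  "(\<And>i. coeff p i \<in> V) \<Longrightarrow> (\<And>i. coeff s i \<in> V) \<Longrightarrow> coeff (p * s) i \<in> V"
  unfolding coeff_mult by (intro subring_sum subring_mult)

lemma subring_polynomial_values: "is_subring {poly p y | p. \<forall>i. coeff p i \<in> V}" (is "is_subring ?W")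
  unfolding is_subring_def
proof (intro conjI ballI)
  show "0 \<in> ?W" using subring_zero by (intro CollectI exI[of _ 0]) simp
  show "1 \<in> ?W" using subring_zero subring_one by (intro CollectI exI[of _ 1]) simp
next
  fix a b assume "a \<in> ?W" "b \<in> ?W"
  then obtain p s where "a = poly p y" "b = poly s y" "\<And>i. coeff p i \<in> V" "\<And>i. coeff s i \<in> V"
    by blast
  then show "a - b \<in> ?W" "a * b \<in> ?W"
    using subring_diff subring_coeff_mult
    by (intro CollectI exI[of _ "p - s"], simp, intro CollectI exI[of _ "p * s"], simp)
qed

end

context
  fixes V :: "'a::field set" and \<theta> :: 'a
  assumes V: "is_subring V" and \<theta>: "\<theta> \<in> V" "inverse \<theta> \<notin> V"
    and maximal: "\<And>W. is_subring W \<Longrightarrow> V \<subseteq> W \<Longrightarrow> inverse \<theta> \<notin> W \<Longrightarrow> W = V"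
begin

text \<open>
  Otherwise the localization of \<open>V\<close> at the powers of \<open>1 + \<theta> * v\<close>
  would be a larger subring without \<open>inverse \<theta>\<close>, because these powers are all
  congruent to \<open>1\<close> modulo \<open>\<theta>\<close>.
\<close>

lemma maximal_subring_unit:
  assumes v: "v \<in> V"
  shows "1 + \<theta> * v \<noteq> 0" "inverse (1 + \<theta> * v) \<in> V"
proof -
  let ?z = "1 + \<theta> * v"
  have \<theta>0: "\<theta> \<noteq> 0" using \<theta> by auto
  have pow: "\<exists>w\<in>V. ?z ^ k = 1 + \<theta> * w" for k
  proof (induction k)
    case (Suc k)
    then obtain w where w: "w \<in> V" "?z ^ k = 1 + \<theta> * w" by blast
    have "?z ^ Suc k = 1 + \<theta> * (w + v * (1 + \<theta> * w))"
      by (simp add: w(2) algebra_simps)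
    moreover have "w + v * (1 + \<theta> * w) \<in> V"
      by (intro subring_add[OF V] subring_mult[OF V] subring_one[OF V] v w \<theta>)
    ultimately show ?case by blast
  qed (use subring_zero[OF V] in \<open>auto intro: bexI[of _ 0]\<close>)
  have not_div: "?z ^ k \<noteq> \<theta> * x" if "x \<in> V" for k x
  proof
    assume "?z ^ k = \<theta> * x"
    then obtain w where w: "w \<in> V" "1 + \<theta> * w = \<theta> * x" using pow[of k] by auto
    then have "\<theta> * (x - w) = 1" by (simp add: algebra_simps)
    then have "inverse \<theta> = x - w" by (rule inverse_unique)
    then show False using \<theta>(2) subring_diff[OF V that w(1)] by simp
  qed
  show z0: "?z \<noteq> 0" using not_div[OF subring_zero[OF V], of 1] by simp
  \<comment> \<open>the localization of \<open>V\<close> at the powers of \<open>?z\<close>\<close>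
  let ?W = "{x. \<exists>k. x * ?z ^ k \<in> V}"
  have z: "?z ^ k \<in> V" for k
    by (intro subring_power[OF V] subring_add[OF V] subring_mult[OF V] subring_one[OF V] \<theta> v)
  have "is_subring ?W"
    unfolding is_subring_def
  proof (intro conjI ballI)
    show "0 \<in> ?W" "1 \<in> ?W" using subring_zero[OF V] z[of 0] by (auto intro: exI[of _ 0])
  next
    fix x y assume "x \<in> ?W" "y \<in> ?W"
    then obtain k l where kl: "x * ?z ^ k \<in> V" "y * ?z ^ l \<in> V" by blast
    have "(x * ?z ^ k) * ?z ^ l - (y * ?z ^ l) * ?z ^ k \<in> V"
      by (intro subring_diff[OF V] subring_mult[OF V] kl z)
    then have "(x - y) * ?z ^ (k + l) \<in> V" by (simp add: algebra_simps power_add)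
    then show "x - y \<in> ?W" by blast
    have "(x * ?z ^ k) * (y * ?z ^ l) \<in> V"
      by (intro subring_mult[OF V] kl)
    then have "(x * y) * ?z ^ (k + l) \<in> V" by (simp only: power_add ac_simps)
    then show "x * y \<in> ?W" by blast
  qed
  moreover have "V \<subseteq> ?W" by (auto intro: exI[of _ 0])
  moreover have "inverse \<theta> \<notin> ?W"
  proof
    assume "inverse \<theta> \<in> ?W"
    then obtain k where "inverse \<theta> * ?z ^ k \<in> V" by blast
    then show False using not_div[of "inverse \<theta> * ?z ^ k" k] \<theta>0 by simp
  qed
  ultimately have "?W = V" by (rule maximal)
  moreover have "inverse ?z \<in> ?W" using z0 subring_one[OF V] by (auto intro!: exI[of _ 1])
  ultimately show "inverse ?z \<in> V" by blast
qed

text \<open>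
  The classical argument of Chevalley: the relation of smaller degree, normalized by the unit
  \<open>1 - \<theta> * coeff s 0\<close>, eliminates the leading term of the other one, so of two
  relations of minimal degree one could still be shortened.
\<close>

lemma maximal_subring_no_two_relations:
  assumes "y \<noteq> 0" and "\<And>i. coeff p i \<in> V" "\<theta> * poly p y = 1"
    and "\<And>i. coeff s i \<in> V" "\<theta> * poly s (inverse y) = 1"
  shows False
  using assms
proof (induction "degree p + degree s" arbitrary: p s y rule: less_induct)
  case less
  \<comment> \<open>the relation for \<open>inverse y\<close> becomes a monic equation for \<open>y\<close>\<close>
  have shorten: "\<exists>p'. degree p' < degree p \<and> (\<forall>i. coeff p' i \<in> V) \<and> \<theta> * poly p' y = 1"
    if y: "y \<noteq> 0" and p: "\<And>i. coeff p i \<in> V" "\<theta> * poly p y = 1"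
      and s: "\<And>i. coeff s i \<in> V" "\<theta> * poly s (inverse y) = 1" and le: "degree s \<le> degree p"
    for p s y
  proof -
    let ?m = "degree s" and ?t = "reflect_poly s" and ?u = "1 + \<theta> * (- coeff s 0)"
    have u: "?u \<noteq> 0" "inverse ?u \<in> V"
      using maximal_subring_unit[of "- coeff s 0"] s(1) subring_uminus[OF V] by blast+
    let ?f = "smult (inverse ?u) (monom 1 ?m - smult \<theta> ?t)"
    have t: "coeff ?t i \<in> V" for i
      using s(1) subring_zero[OF V] by (simp add: coeff_reflect_poly)
    have f: "coeff ?f i \<in> V" for i
      using t subring_zero[OF V] subring_one[OF V] unfolding coeff_smult coeff_diff coeff_monom
      by (intro subring_mult[OF V] subring_diff[OF V] u \<theta>) auto
    have "poly ?t y = y ^ ?m * poly s (inverse y)"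
      using y by (simp add: poly_reflect_poly_nz)
    then have "\<theta> * poly ?t y = y ^ ?m * (\<theta> * poly s (inverse y))" by simp
    then have f0: "poly ?f y = 0" using s(2) by (simp add: poly_monom)
    have fm: "coeff ?f ?m = 1" using u(1) by (simp add: coeff_reflect_poly)
    have "degree ?f \<le> ?m"
      by (intro order_trans[OF degree_smult_le] degree_diff_le order_trans[OF degree_smult_le])
         (simp_all add: degree_monom_le degree_reflect_poly_le)
    \<comment> \<open>\<open>?f\<close> is monic of degree \<open>?m\<close>, so this multiple cancels the leading term of \<open>p\<close>\<close>
    let ?g = "monom (lead_coeff p) (degree p - ?m) * ?f"
    have "degree ?g \<le> degree p"
      using degree_mult_le[of "monom (lead_coeff p) (degree p - ?m)" ?f] \<open>degree ?f \<le> ?m\<close> le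
        degree_monom_le[of "lead_coeff p" "degree p - ?m"] by linarith
    then have "degree (p - ?g) \<le> degree p" by (simp add: degree_diff_le)
    moreover have "coeff (p - ?g) (degree p) = 0"
      using le fm by (simp only: coeff_diff coeff_monom_mult) simp
    ultimately have "p - ?g = 0 \<or> degree (p - ?g) < degree p" by (rule eq_zero_or_degree_less)
    moreover have val: "\<theta> * poly (p - ?g) y = 1"
      unfolding poly_diff poly_mult f0 using p(2) by simp
    moreover have "coeff (p - ?g) i \<in> V" for i
    proof -
      have "coeff (monom (lead_coeff p) (degree p - ?m)) j \<in> V" for j
        using p(1) subring_zero[OF V] by simp
      then show ?thesis
        using p(1) subring_coeff_mult[OF V _ f] unfolding coeff_diff
        by (intro subring_diff[OF V]) blast+
    qed
    moreover have "p - ?g \<noteq> 0"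
    proof
      assume "p - ?g = 0"
      then have "poly (p - ?g) y = 0" by (simp only: poly_0)
      with val show False by (simp only: mult_zero_right zero_neq_one)
    qed
    ultimately show ?thesis by blast
  qed
  show False
  proof (cases "degree s \<le> degree p")
    case True
    then obtain p' where "degree p' < degree p" "\<forall>i. coeff p' i \<in> V" "\<theta> * poly p' y = 1"
      using shorten[OF less.prems] by blast
    then show False using less.hyps[of p' s y] less.prems by auto
  next
    case False
    then obtain s' where "degree s' < degree s" "\<forall>i. coeff s' i \<in> V" "\<theta> * poly s' (inverse y) = 1"
      using shorten[of "inverse y" s p] less.prems by auto
    then show False using less.hyps[of p s' y] less.prems by auto
  qed
qed

text \<open>
  If neither \<open>y\<close> nor \<open>inverse y\<close> lies in \<open>V\<close>, then by
  maximality \<open>inverse \<theta>\<close> lies in both \<open>V[y]\<close> and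
  \<open>V[inverse y]\<close>, which are the two relations just excluded.
\<close>

lemma maximal_subring_valuation_ring: "y \<in> V \<or> inverse y \<in> V"
proof (rule ccontr)
  assume neg: "\<not> (y \<in> V \<or> inverse y \<in> V)"
  then have y: "y \<noteq> 0" using subring_zero[OF V] by auto
  have \<theta>0: "\<theta> \<noteq> 0" using \<theta> by auto
  have relation: "\<exists>p. (\<forall>i. coeff p i \<in> V) \<and> \<theta> * poly p x = 1" if "x \<notin> V" for x
  proof -
    let ?W = "{poly p x | p. \<forall>i. coeff p i \<in> V}"
    have "V \<subseteq> ?W"
    proof
      fix v assume "v \<in> V"
      then show "v \<in> ?W"
        using subring_zero[OF V]
        by (intro CollectI exI[of _ "[:v:]"]) (auto simp: coeff_pCons split: nat.split)
    qed
    moreover have "x \<in> ?W"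
      using subring_zero[OF V] subring_one[OF V]
      by (intro CollectI exI[of _ "monom 1 1"]) (auto simp: poly_monom)
    ultimately have "inverse \<theta> \<in> ?W"
      using maximal[OF subring_polynomial_values[OF V]] that by blast
    then show ?thesis using \<theta>0 by (auto dest!: sym[of "inverse \<theta>"])
  qed
  show False
    using relation[of y] relation[of "inverse y"] neg maximal_subring_no_two_relations[OF y]
    by blast
qed

end

lemma maximal_subring_exists:
  assumes A: "is_subring A" "x \<notin> A"
  shows "\<exists>V. is_subring V \<and> A \<subseteq> V \<and> x \<notin> V \<and> (\<forall>W. is_subring W \<and> V \<subseteq> W \<and> x \<notin> W \<longrightarrow> W = V)"
proof -
  let ?S = "{V. is_subring V \<and> A \<subseteq> V \<and> x \<notin> V}"
  have "\<exists>M\<in>?S. \<forall>X\<in>?S. M \<subseteq> X \<longrightarrow> X = M"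
  proof (rule subset_Zorn_nonempty)
    fix C assume C: "C \<noteq> {}" "subset.chain ?S C"
    have both: "\<exists>t\<in>C. z \<in> t \<and> w \<in> t" if "z \<in> \<Union>C" "w \<in> \<Union>C" for z w
      using that C(2) unfolding subset_chain_def by blast
    have sub: "is_subring V" "A \<subseteq> V" "x \<notin> V" if "V \<in> C" for V
      using C(2) that by (auto simp: subset_chain_def)
    have "is_subring (\<Union>C)"
      unfolding is_subring_def
    proof (intro conjI ballI)
      show "0 \<in> \<Union>C" "1 \<in> \<Union>C" using C(1) sub subring_zero subring_one by blast+
    next
      fix a b assume "a \<in> \<Union>C" "b \<in> \<Union>C"
      then obtain t where "t \<in> C" "a \<in> t" "b \<in> t" using both by blast
      then show "a - b \<in> \<Union>C" "a * b \<in> \<Union>C"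
        using sub(1) subring_diff[of t a b] subring_mult[of t a b] by blast+
    qed
    then show "\<Union>C \<in> ?S" using C(1) sub by blast
  qed (use A in blast)
  then show ?thesis by (auto dest: subset_trans)
qed

section \<open>Finite subfields and their Frobenius map\<close>

locale finite_subfield =
  fixes F :: "'a::field set"
  assumes finite: "finite F" and subfield: "is_subfield F"
begin

lemma zero_mem: "0 \<in> F" and one_mem: "1 \<in> F"
  and diff_mem: "x \<in> F \<Longrightarrow> y \<in> F \<Longrightarrow> x - y \<in> F"
  and mult_mem: "x \<in> F \<Longrightarrow> y \<in> F \<Longrightarrow> x * y \<in> F"
  and inverse_mem: "x \<in> F \<Longrightarrow> inverse x \<in> F"
  using subfield by (auto simp: is_subfield_def)

lemma uminus_mem: "x \<in> F \<Longrightarrow> - x \<in> F"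
  using diff_mem[OF zero_mem] by simp

lemma add_mem: "x \<in> F \<Longrightarrow> y \<in> F \<Longrightarrow> x + y \<in> F"
  using diff_mem[of x "- y"] uminus_mem[of y] by simp

lemma card_ge_2: "card F \<ge> 2"
proof -
  have "card {0, 1 :: 'a} \<le> card F"
    using finite zero_mem one_mem by (intro card_mono) auto
  then show ?thesis by simp
qed

lemma power_card_minus_1:
  assumes c: "c \<in> F" "c \<noteq> 0"
  shows "c ^ (card F - 1) = 1"
proof -
  have "(\<lambda>x. c * x) ` (F - {0}) = F - {0}"
  proof (rule card_subset_eq)
    show "(\<lambda>x. c * x) ` (F - {0}) \<subseteq> F - {0}" using c mult_mem by auto
    show "card ((\<lambda>x. c * x) ` (F - {0})) = card (F - {0})"
      using c by (intro card_image) (auto simp: inj_on_def)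
  qed (use finite in simp)
  then have "(\<Prod>x\<in>F - {0}. x) = (\<Prod>x\<in>(\<lambda>x. c * x) ` (F - {0}). x)" by simp
  also have "\<dots> = (\<Prod>x\<in>F - {0}. c * x)"
    using c by (subst prod.reindex) (auto simp: inj_on_def)
  also have "\<dots> = c ^ (card F - 1) * (\<Prod>x\<in>F - {0}. x)"
    using zero_mem by (simp add: prod.distrib card_Diff_singleton)
  finally show ?thesis using finite by simp
qed

lemma power_card:
  assumes "c \<in> F"
  shows "c ^ card F = c"
proof (cases "c = 0")
  case False
  have "c ^ card F = c ^ Suc (card F - 1)" using card_ge_2 by simp
  also have "\<dots> = c" using power_card_minus_1[OF assms False] by (simp del: Suc_diff_1)
  finally show ?thesis .
qed (use card_ge_2 in simp)

text \<open>
  Used for differences of monic polynomials of degree \<open>card F\<close> that agree on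
  \<open>F\<close>.
\<close>

lemma eq_zero_if_many_roots:
  fixes p :: "'a poly"
  assumes "degree p \<le> card F" "coeff p (card F) = 0" "\<And>c. c \<in> F \<Longrightarrow> poly p c = 0"
  shows "p = 0"
proof (rule ccontr)
  assume p: "p \<noteq> 0"
  then have "degree p < card F" using eq_zero_or_degree_less[OF assms(1,2)] by blast
  moreover have "card F \<le> card {x. poly p x = 0}"
    using assms(3) p by (intro card_mono poly_roots_finite) auto
  moreover have "card {x. poly p x = 0} \<le> degree p"
    using p by (rule card_poly_roots_bound)
  ultimately show False by simp
qed

lemma prod_minus_eq: "(\<Prod>c\<in>F. x - c) = x ^ card F - x"
proof -
  let ?g = "\<Prod>c\<in>F. [:- c, 1:]" and ?h = "monom 1 (card F) - monom 1 1 :: 'a poly"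
  have deg: "degree ?g = card F" by (subst degree_prod_eq_sum_degree) auto
  then have lead: "coeff ?g (card F) = 1" using lead_coeff_prod[of "\<lambda>c. [:- c, 1:]" F] by simp
  have "?h - ?g = 0"
  proof (rule eq_zero_if_many_roots)
    show "degree (?h - ?g) \<le> card F"
      using card_ge_2 deg
      by (intro degree_diff_le) (auto simp: degree_monom_eq intro: order_trans[OF degree_monom_le])
    show "coeff (?h - ?g) (card F) = 0" using lead card_ge_2 by simp
    show "poly (?h - ?g) c = 0" if "c \<in> F" for c
      using that finite power_card[OF that]
      by (auto simp: poly_monom poly_prod intro!: prod_zero)
  qed
  then have "poly ?h x = poly ?g x" by simp
  then show ?thesis by (simp add: poly_monom poly_prod)
qed

text \<open>
  By the product formula \<open>x ^ card F - x\<close> is invariant under translations by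
  \<open>F\<close>, so \<open>(x + y) ^ card F - x ^ card F - y ^ card F\<close>, as a polynomial in
  \<open>x\<close> of degree less than \<open>card F\<close>, vanishes on all of \<open>F\<close>.
\<close>

lemma frobenius_add:
  fixes x y :: 'a
  shows "(x + y) ^ card F = x ^ card F + y ^ card F"
proof -
  have translate: "(c + y) ^ card F = c + y ^ card F" if c: "c \<in> F" for c
  proof -
    \<comment> \<open>\<open>x ^ card F - x\<close> takes the same value at \<open>c + y\<close> and at \<open>y\<close>, and \<open>c ^ card F = c\<close>\<close>
    have "(\<lambda>d. d + c) ` F = F"
    proof (rule card_subset_eq)
      show "(\<lambda>d. d + c) ` F \<subseteq> F" using c add_mem by auto
    qed (use finite in \<open>auto intro: card_image\<close>)
    then have "(\<Prod>d\<in>F. (c + y) - d) = (\<Prod>d\<in>(\<lambda>d. d + c) ` F. (c + y) - d)" by simp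
    also have "\<dots> = (\<Prod>d\<in>F. y - d)" by (subst prod.reindex) (auto simp: algebra_simps)
    finally show ?thesis unfolding prod_minus_eq by (simp add: algebra_simps)
  qed
  let ?h = "[:y, 1:] ^ card F - monom 1 (card F) - [:y ^ card F:]"
  have deg: "degree ([:y, 1:] ^ card F) = card F" by (simp add: degree_power_eq)
  have "?h = 0"
  proof (rule eq_zero_if_many_roots)
    show "degree ?h \<le> card F"
      using deg by (intro degree_diff_le) (auto simp: degree_monom_eq)
    have "coeff ([:y, 1:] ^ card F) (card F) = 1"
      using lead_coeff_power[of "[:y, 1:]" "card F"] deg by simp
    then show "coeff ?h (card F) = 0"
      using card_ge_2 by (simp add: coeff_pCons split: nat.split)
    show "poly ?h c = 0" if "c \<in> F" for c
      using translate[OF that] power_card[OF that] by (simp add: poly_monom poly_power add.commute)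
  qed
  then have "poly ?h x = 0" by simp
  then show ?thesis by (simp add: poly_monom poly_power algebra_simps)
qed

lemma frobenius_uminus:
  fixes x :: 'a
  shows "(- x) ^ card F = - (x ^ card F)"
  using frobenius_add[of x "- x"] card_ge_2 by (simp add: zero_power eq_neg_iff_add_eq_0 add.commute)

lemma frobenius_diff:
  fixes x y :: 'a
  shows "(x - y) ^ card F = x ^ card F - y ^ card F"
  using frobenius_add[of x "- y"] frobenius_uminus[of y] by simp

lemma frobenius_sum:
  fixes f :: "'i \<Rightarrow> 'a"
  shows "(\<Sum>i\<in>I. f i) ^ card F = (\<Sum>i\<in>I. f i ^ card F)"
proof (induction I rule: infinite_finite_induct)
  case (insert i I)
  then show ?case by (simp add: frobenius_add)
qed (use card_ge_2 in \<open>auto simp: zero_power\<close>)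

lemma positive_characteristic: "\<exists>p>0. of_nat p = (0 :: 'a)"
proof -
  have "of_nat n \<in> F" for n by (induction n) (auto intro: zero_mem one_mem add_mem)
  then have "\<not> inj (of_nat :: nat \<Rightarrow> 'a)"
    using finite finite_subset[of "range of_nat" F] finite_imageD[of "of_nat :: nat \<Rightarrow> 'a" UNIV]
    by auto
  then obtain m n :: nat where "m < n" "of_nat m = (of_nat n :: 'a)"
    unfolding inj_def by (metis linorder_neqE_nat)
  then show ?thesis by (intro exI[of _ "n - m"]) (simp add: of_nat_diff)
qed

end

section \<open>The difference equation of the Anderson-Thakur function\<close>

lemma nav_power: "absv (x ^ n) = absv (x :: 'a::nonarch_valued_field) ^ n"
  by (induction n) (simp_all add: nav_one nav_mult)

lemma nav_tendsto_diff:
  fixes f g :: "nat \<Rightarrow> 'a::nonarch_valued_field"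
  assumes "f \<longlonglongrightarrow> a" "g \<longlonglongrightarrow> b"
  shows "(\<lambda>n. f n - g n) \<longlonglongrightarrow> a - b"
proof -
  have "(\<lambda>n. dist (f n) a + dist (g n) b) \<longlonglongrightarrow> 0 + 0"
    using assms by (intro tendsto_add) (simp_all add: tendsto_dist_iff[symmetric])
  moreover have "dist (f n - g n) (a - b) \<le> dist (f n) a + dist (g n) b" for n
    using nav_diff_le[of "f n - a" "g n - b"] nav_nonneg[of "f n - a"] nav_nonneg[of "g n - b"]
    by (simp add: dist_absv algebra_simps)
  ultimately have "(\<lambda>n. dist (f n - g n) (a - b)) \<longlonglongrightarrow> 0"
    by (intro tendsto_sandwich[of "\<lambda>_. 0" "\<lambda>n. dist (f n - g n) (a - b)" sequentially
          "\<lambda>n. dist (f n) a + dist (g n) b"]) auto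
  then show ?thesis by (simp add: tendsto_dist_iff[symmetric])
qed

lemma nav_tendsto_mult_left:
  fixes f :: "nat \<Rightarrow> 'a::nonarch_valued_field"
  assumes "f \<longlonglongrightarrow> a"
  shows "(\<lambda>n. c * f n) \<longlonglongrightarrow> c * a"
proof -
  have "(\<lambda>n. absv c * dist (f n) a) \<longlonglongrightarrow> absv c * 0"
    using assms by (intro tendsto_mult_left) (simp add: tendsto_dist_iff[symmetric])
  moreover have "dist (c * f n) (c * a) = absv c * dist (f n) a" for n
    by (simp add: dist_absv nav_mult[symmetric] algebra_simps)
  ultimately show ?thesis by (subst tendsto_dist_iff) simp
qed

context finite_subfield
begin

text \<open>
  The Frobenius twist of the theory of t-motives; it is a ring homomorphism that fixes
  \<open>t\<close>.
\<close>

definition twist :: "'a fps \<Rightarrow> 'a fps" where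
  "twist f = Abs_fps (\<lambda>n. fps_nth f n ^ card F)"

lemma twist_mult: "twist (f * g) = twist f * twist g"
  by (simp add: twist_def fps_eq_iff fps_mult_nth frobenius_sum power_mult_distrib)

lemma twist_const: "twist (fps_const c) = fps_const (c ^ card F)"
  using card_ge_2 by (auto simp: twist_def fps_eq_iff)

lemma twist_one: "twist 1 = 1"
  using card_ge_2 by (auto simp: twist_def fps_eq_iff)

lemma twist_X: "twist fps_X = fps_X"
  using card_ge_2 by (auto simp: twist_def fps_eq_iff)

lemma twist_add: "twist (f + g) = twist f + twist g"
  by (simp add: twist_def fps_eq_iff frobenius_add)

lemma twist_diff: "twist (f - g) = twist f - twist g"
  by (simp add: twist_def fps_eq_iff frobenius_diff)

lemma twist_power: "twist (f ^ n) = twist f ^ n"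
  by (induction n) (simp_all add: twist_one twist_mult)

lemma twist_sum: "twist (\<Sum>i\<in>I. f i) = (\<Sum>i\<in>I. twist (f i))"
proof (induction I rule: infinite_finite_induct)
  case (insert i I)
  then show ?case by (simp add: twist_add)
qed (use twist_diff[of 0 0] in simp_all)

end

text \<open>
  The condition on the absolute value makes the product for \<open>\<Omega>\<close> converge and
  \<open>\<theta>\<close> transcendental over \<open>F\<close>.
\<close>

locale carlitz = finite_subfield F
  for F :: "'c::{nonarch_valued_field, complete_space} set" +
  fixes \<theta> :: 'c
  assumes absv_theta: "absv \<theta> = real (card F)"
begin

lemma theta_nonzero: "\<theta> \<noteq> 0"
  using absv_theta card_ge_2 nav_eq_zero[of \<theta>] by auto

text \<open>
  The Frobenius moves the zero \<open>\<theta> ^ (q ^ j)\<close> of the product to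
  \<open>\<theta> ^ (q ^ (j + 1))\<close>, and the missing factor for \<open>j = 1\<close> is
  supplied.
\<close>

lemma twist_Omega_partial:
  "twist (Omega_partial (card F) \<theta> N) * (1 - fps_const (inverse (\<theta> ^ card F)) * fps_X)
     = Omega_partial (card F) \<theta> (Suc N)"
proof (induction N)
  case 0
  then show ?case by (simp add: Omega_partial_def twist_one)
next
  case (Suc N)
  let ?q = "card F" and ?L = "\<lambda>n. 1 - fps_const (inverse (\<theta> ^ (card F ^ n))) * fps_X"
  have "twist (?L (Suc N)) = ?L (Suc (Suc N))"
    by (simp add: twist_diff twist_one twist_mult twist_const twist_X power_inverse
        power_mult[symmetric] mult.commute)
  then have "twist (Omega_partial ?q \<theta> (Suc N)) * ?L 1
      = (twist (Omega_partial ?q \<theta> N) * ?L 1) * ?L (Suc (Suc N))"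
    by (simp only: Omega_partial_Suc twist_mult ac_simps)
  then show ?case
    unfolding Omega_partial_Suc[of _ _ "Suc N"] using Suc.IH by simp
qed

definition Omega_unnormalized :: "'c fps" where
  "Omega_unnormalized = Abs_fps (\<lambda>n. lim (\<lambda>N. fps_nth (Omega_partial (card F) \<theta> N) n))"

lemma Omega_partial_tendsto:
  "(\<lambda>N. fps_nth (Omega_partial (card F) \<theta> N) n) \<longlonglongrightarrow> fps_nth Omega_unnormalized n"
  using convergent_nth_Omega_partial[of \<theta> "card F" n] absv_theta card_ge_2
  by (simp add: Omega_unnormalized_def convergent_LIMSEQ_iff)

lemma tendsto_frobenius:
  fixes f :: "nat \<Rightarrow> 'c"
  assumes "f \<longlonglongrightarrow> a"
  shows "(\<lambda>n. f n ^ card F) \<longlonglongrightarrow> a ^ card F"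
proof -
  have "(\<lambda>n. dist (f n) a ^ card F) \<longlonglongrightarrow> 0 ^ card F"
    using assms by (intro tendsto_power) (simp add: tendsto_dist_iff[symmetric])
  moreover have "dist (f n ^ card F) (a ^ card F) = dist (f n) a ^ card F" for n
    by (simp add: dist_absv nav_power[symmetric] frobenius_diff)
  ultimately show ?thesis
    using card_ge_2 by (subst tendsto_dist_iff) (simp add: zero_power)
qed

lemma twist_Omega_unnormalized:
  "twist Omega_unnormalized * (1 - fps_const (inverse (\<theta> ^ card F)) * fps_X) = Omega_unnormalized"
proof (rule fps_ext)
  fix n
  let ?P = "\<lambda>N. fps_nth (Omega_partial (card F) \<theta> N)" and ?a = "inverse (\<theta> ^ card F)"
  let ?O = "fps_nth Omega_unnormalized"
  have "(\<lambda>N. ?P N n ^ card F - (if n = 0 then 0 else ?a * ?P N (n - 1) ^ card F))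
      \<longlonglongrightarrow> ?O n ^ card F - (if n = 0 then 0 else ?a * ?O (n - 1) ^ card F)"
    by (intro nav_tendsto_diff tendsto_frobenius Omega_partial_tendsto)
       (auto intro!: nav_tendsto_mult_left tendsto_frobenius Omega_partial_tendsto)
  then have "(\<lambda>N. ?P (Suc N) n)
      \<longlonglongrightarrow> fps_nth (twist Omega_unnormalized * (1 - fps_const ?a * fps_X)) n"
    unfolding twist_Omega_partial[symmetric] fps_nth_linear_mult
    by (cases n) (simp_all add: twist_def)
  moreover have "(\<lambda>N. ?P (Suc N) n) \<longlonglongrightarrow> ?O n"
    using Omega_partial_tendsto by (rule LIMSEQ_Suc)
  ultimately show "fps_nth (twist Omega_unnormalized * (1 - fps_const ?a * fps_X)) n = ?O n"
    by (rule LIMSEQ_unique)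
qed

lemma Omega_unnormalized_0: "fps_nth Omega_unnormalized 0 = 1"
proof -
  have "fps_nth (Omega_partial (card F) \<theta> N) 0 = 1" for N
  proof (induction N)
    case (Suc N)
    then show ?case unfolding Omega_partial_Suc fps_nth_linear_mult by simp
  qed (simp add: Omega_partial_def)
  then have "(\<lambda>N. 1) \<longlonglongrightarrow> fps_nth Omega_unnormalized 0"
    using Omega_partial_tendsto[of 0] by simp
  then show ?thesis by (rule LIMSEQ_unique[OF _ tendsto_const])
qed

text \<open>
  The normalization \<open>lam ^ (q - 1) = - \<theta>\<close> turns the equation for the product into
  \<open>\<Omega> = (t - \<theta> ^ q) * twist \<Omega>\<close>, hence
  \<open>(t - \<theta>) * \<Omega>\<close> is the inverse of a power series \<open>W\<close> with
  \<open>twist W = (t - \<theta>) * W\<close> and constant coefficient \<open>lam\<close>.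
\<close>

lemma anderson_thakur_coefficients:
  assumes lam: "lam ^ (card F - 1) = - \<theta>"
  shows "\<exists>W. anderson_thakur (card F) \<theta> lam = fps_to_fls W \<and> fps_nth W 0 = lam \<and>
    twist W = W * (fps_X - fps_const \<theta>)"
proof -
  define q where "q = card F"
  have q: "q \<ge> 2" unfolding q_def by (rule card_ge_2)
  have lam0: "lam \<noteq> 0" using lam theta_nonzero q by (auto simp: q_def zero_power)
  have lam_q: "lam ^ q = - \<theta> * lam"
    using lam q power_Suc2[of lam "q - 1"] by (simp add: q_def)
  let ?O = "Omega q \<theta> lam" and ?P = Omega_unnormalized
  have O: "?O = fps_const (inverse (lam ^ q)) * ?P"
    by (simp add: Omega_def Omega_unnormalized_def q_def)
  define G where "G = (fps_X - fps_const \<theta>) * ?O"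
  define W where "W = inverse G"
  have O0: "fps_nth ?O 0 = inverse (lam ^ q)"
    unfolding O by (simp add: Omega_unnormalized_0)
  then have G0: "fps_nth G 0 = - \<theta> * inverse (lam ^ q)"
    by (simp add: G_def)
  then have "fps_nth G 0 \<noteq> 0" using theta_nonzero lam0 by simp
  then have WG: "W * G = 1" unfolding W_def by (rule inverse_mult_eq_1)
  have "inverse (lam ^ q) ^ q * - (\<theta> ^ q) = inverse (lam ^ q)"
  proof -
    have "(lam ^ q) ^ q = - (\<theta> ^ q) * lam ^ q"
      unfolding lam_q[THEN arg_cong[of _ _ "\<lambda>x. x ^ q"]]
      by (simp add: power_mult_distrib frobenius_uminus q_def)
    then show ?thesis using lam0 theta_nonzero by (simp add: power_inverse field_simps)
  qed
  then have "twist ?O * (fps_X - fps_const (\<theta> ^ q)) = ?O"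
  proof -
    assume c: "inverse (lam ^ q) ^ q * - (\<theta> ^ q) = inverse (lam ^ q)"
    have "fps_X - fps_const (\<theta> ^ q)
        = fps_const (- (\<theta> ^ q)) * (1 - fps_const (inverse (\<theta> ^ q)) * fps_X)"
      using theta_nonzero by (simp add: right_diff_distrib mult.assoc[symmetric] fps_const_mult
          fps_const_neg[symmetric] del: fps_const_neg)
    then have "twist ?O * (fps_X - fps_const (\<theta> ^ q))
        = fps_const (inverse (lam ^ q) ^ q * - (\<theta> ^ q))
            * (twist ?P * (1 - fps_const (inverse (\<theta> ^ q)) * fps_X))"
      unfolding O twist_mult twist_const
      by (simp only: q_def[symmetric] ac_simps fps_const_mult[symmetric])
    then show ?thesis
      unfolding c using twist_Omega_unnormalized by (simp add: q_def[symmetric] O)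
  qed
  then have "twist G = ?O"
    unfolding G_def by (simp add: twist_mult twist_diff twist_X twist_const q_def mult.commute)
  then have "twist W * ?O = W * (fps_X - fps_const \<theta>) * ?O"
    using WG twist_mult[of W G] by (simp add: twist_one G_def mult.assoc)
  moreover have "?O \<noteq> 0" using O0 lam0 by auto
  ultimately have tw: "twist W = W * (fps_X - fps_const \<theta>)" by simp
  have "fps_nth W 0 = lam"
  proof -
    have "fps_nth G 0 * lam = 1"
      unfolding G0 using lam0 theta_nonzero by (simp add: lam_q field_simps)
    then show ?thesis unfolding W_def by (simp add: inverse_unique)
  qed
  moreover have "anderson_thakur q \<theta> lam = fps_to_fls W"
  proof -
    have G: "(fls_X - fls_const \<theta>) * fps_to_fls ?O = fps_to_fls G"
      unfolding G_def by (simp add: fls_times_fps_to_fls fps_to_fls_minus)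
    have "fps_to_fls W * fps_to_fls G = 1"
      using WG by (simp add: fls_times_fps_to_fls[symmetric])
    then show ?thesis
      unfolding anderson_thakur_def G by (metis divide_inverse inverse_unique mult.commute mult_1)
  qed
  ultimately show ?thesis using tw unfolding q_def by blast
qed

end

section \<open>Total ramification above \<open>\<theta>\<close>\<close>

context carlitz
begin

lemma absv_constant:
  assumes "c \<in> F" "c \<noteq> 0"
  shows "absv c = 1"
proof -
  have "absv c ^ (card F - 1) = 1 ^ (card F - 1)"
    using power_card_minus_1[OF assms] by (simp add: nav_power[symmetric] nav_one)
  then show ?thesis
    using card_ge_2 nav_nonneg by (rule_tac power_eq_imp_eq_base[of _ "card F - 1"]) auto
qed

text \<open>
  The leading term dominates: by induction all nonzero values have absolute value at least
  \<open>1\<close>, because nonzero constants have absolute value \<open>1\<close> and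
  \<open>\<theta>\<close> has absolute value at least \<open>2\<close>.
\<close>

lemma theta_transcendental:
  assumes "\<And>i. coeff p i \<in> F" "p \<noteq> 0"
  shows "poly p \<theta> \<noteq> 0"
proof -
  have "absv (poly p \<theta>) \<ge> 1"
    using assms
  proof (induction p)
    case (pCons a p)
    have a: "a \<in> F" using pCons.prems(1)[of 0] by simp
    have p: "coeff p i \<in> F" for i using pCons.prems(1)[of "Suc i"] by simp
    show ?case
    proof (cases "p = 0")
      case True
      then show ?thesis using pCons.hyps a by (simp add: absv_constant)
    next
      case False
      then have "1 \<le> absv (poly p \<theta>)" using pCons.IH p by simp
      then have "2 * 1 \<le> absv \<theta> * absv (poly p \<theta>)"
        using card_ge_2 absv_theta by (intro mult_mono) auto
      then have "2 \<le> absv (\<theta> * poly p \<theta>)" by (simp add: nav_mult)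
      moreover have "absv (\<theta> * poly p \<theta>) \<le> max (absv (a + \<theta> * poly p \<theta>)) (absv a)"
        using nav_diff_le[of "a + \<theta> * poly p \<theta>" a] by simp
      moreover have "absv a \<le> 1"
        using absv_constant[OF a] nav_eq_zero[of a] by (cases "a = 0") auto
      ultimately show ?thesis by auto
    qed
  qed simp
  then show ?thesis using nav_eq_zero[of "poly p \<theta>"] by auto
qed

text \<open>
  A valuation ring above the prime \<open>\<theta>\<close> of \<open>F[\<theta>]\<close>. The absolute
  value of the class belongs to the infinite place instead.
\<close>

lemma valuation_ring_exists:
  "\<exists>V. is_subring V \<and> F \<subseteq> V \<and> \<theta> \<in> V \<and>
     (\<forall>v\<in>V. 1 + \<theta> * v \<noteq> 0 \<and> inverse (1 + \<theta> * v) \<in> V) \<and> (\<forall>y. y \<in> V \<or> inverse y \<in> V)"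
proof -
  let ?A = "{poly p \<theta> | p. \<forall>i. coeff p i \<in> F}"
  have F: "is_subring F" using subfield by (simp add: is_subring_def is_subfield_def)
  have A: "is_subring ?A" by (rule subring_polynomial_values[OF F])
  have "F \<subseteq> ?A"
  proof
    fix c assume "c \<in> F"
    then show "c \<in> ?A"
      using zero_mem by (intro CollectI exI[of _ "[:c:]"]) (auto simp: coeff_pCons split: nat.split)
  qed
  moreover have "\<theta> \<in> ?A"
    using zero_mem one_mem by (intro CollectI exI[of _ "monom 1 1"]) (auto simp: poly_monom)
  moreover have "inverse \<theta> \<notin> ?A"
  proof
    assume "inverse \<theta> \<in> ?A"
    then obtain p where p: "\<And>i. coeff p i \<in> F" "inverse \<theta> = poly p \<theta>" by blast
    have "poly (pCons (- 1) p) \<theta> = 0"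
      using theta_nonzero by (simp add: p(2)[symmetric])
    moreover have "coeff (pCons (- 1) p) i \<in> F" for i
      using p(1) uminus_mem[OF one_mem] by (auto simp: coeff_pCons split: nat.split)
    ultimately show False using theta_transcendental[of "pCons (- 1) p"] by simp
  qed
  ultimately obtain V where V: "is_subring V" "F \<subseteq> V" "\<theta> \<in> V" "inverse \<theta> \<notin> V"
    and maximal: "\<And>W. is_subring W \<Longrightarrow> V \<subseteq> W \<Longrightarrow> inverse \<theta> \<notin> W \<Longrightarrow> W = V"
    using maximal_subring_exists[OF A] by (meson subsetD subset_trans)
  show ?thesis
    using V maximal_subring_unit[OF V(1,3,4) maximal]
      maximal_subring_valuation_ring[OF V(1,3,4) maximal]
    by (intro exI[of _ V]) blast
qed

end

text \<open>
  The properties of \<open>V\<close> on which the ramification argument rests; the valuation itself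
  appears only through units and powers.
\<close>

locale carlitz_valuation = carlitz +
  fixes V :: "'a set"
  assumes V: "is_subring V" and constants: "F \<subseteq> V" and theta_mem: "\<theta> \<in> V"
    and theta_radical: "v \<in> V \<Longrightarrow> 1 + \<theta> * v \<noteq> 0" "v \<in> V \<Longrightarrow> inverse (1 + \<theta> * v) \<in> V"
    and valuation: "y \<in> V \<or> inverse y \<in> V"
begin

definition unit :: "'a \<Rightarrow> bool" where
  "unit u \<longleftrightarrow> u \<in> V \<and> inverse u \<in> V \<and> u \<noteq> 0"

text \<open>
  The Jacobson radical of \<open>V\<close>, which is its maximal ideal: the elements of positive
  value.
\<close>

definition radical :: "'a set" where
  "radical = {x \<in> V. \<forall>v\<in>V. unit (1 + x * v)}"

lemma unit_nonzero: "unit u \<Longrightarrow> u \<noteq> 0"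
  and unit_mem: "unit u \<Longrightarrow> u \<in> V"
  and unit_inverse: "unit u \<Longrightarrow> unit (inverse u)"
  and unit_one: "unit 1"
  using subring_one[OF V] by (auto simp: unit_def)

lemma unit_mult: "unit u \<Longrightarrow> unit w \<Longrightarrow> unit (u * w)"
  by (auto simp: unit_def intro: subring_mult[OF V])

lemma unit_uminus: "unit u \<Longrightarrow> unit (- u)"
  by (auto simp: unit_def intro: subring_uminus[OF V])

lemma unit_power: "unit u \<Longrightarrow> unit (u ^ n)"
  by (induction n) (auto intro: unit_one unit_mult)

lemma unit_power_int: "unit u \<Longrightarrow> unit (u powi n)"
  by (auto simp: power_int_def intro: unit_power unit_inverse)

lemma unit_constant: "c \<in> F \<Longrightarrow> c \<noteq> 0 \<Longrightarrow> unit c"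
  using constants inverse_mem by (auto simp: unit_def)

lemma radical_mem: "x \<in> radical \<Longrightarrow> x \<in> V"
  by (simp add: radical_def)

lemma unit_one_plus: "x \<in> radical \<Longrightarrow> v \<in> V \<Longrightarrow> unit (1 + x * v)"
  by (simp add: radical_def)

lemma theta_in_radical: "\<theta> \<in> radical"
  using theta_radical theta_mem subring_add[OF V subring_one[OF V] subring_mult[OF V theta_mem]]
  unfolding radical_def unit_def by blast

lemma radical_mult:
  assumes x: "x \<in> radical" and v: "v \<in> V"
  shows "x * v \<in> radical"
  using unit_one_plus[OF x subring_mult[OF V v]] subring_mult[OF V radical_mem[OF x] v]
  by (simp add: radical_def mult.assoc)

lemma unit_add_radical:
  assumes u: "unit u" and x: "x \<in> radical"
  shows "unit (u + x)"
proof -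
  have "u + x = u * (1 + x * inverse u)"
    using unit_nonzero[OF u] by (simp add: algebra_simps)
  then show ?thesis
    using unit_mult[OF u unit_one_plus[OF x]] unit_mem[OF unit_inverse[OF u]] by simp
qed

lemma radical_zero: "0 \<in> radical"
  by (auto simp: radical_def intro: unit_one subring_zero[OF V])

lemma radical_add:
  assumes x: "x \<in> radical" and y: "y \<in> radical"
  shows "x + y \<in> radical"
proof -
  have "unit (1 + (x + y) * v)" if "v \<in> V" for v
    using unit_add_radical[OF unit_one_plus[OF x that] radical_mult[OF y that]]
    by (simp add: algebra_simps)
  then show ?thesis using subring_add[OF V] x y by (auto simp: radical_def)
qed

lemma radical_sum: "(\<And>i. i \<in> I \<Longrightarrow> f i \<in> radical) \<Longrightarrow> sum f I \<in> radical"
  by (induction I rule: infinite_finite_induct) (auto intro: radical_zero radical_add)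

lemma radical_power:
  assumes x: "x \<in> radical" and n: "n > 0"
  shows "x ^ n \<in> radical"
proof -
  obtain m where "n = Suc m" using n by (cases n) auto
  then show ?thesis using radical_mult[OF x subring_power[OF V radical_mem[OF x], of m]] by simp
qed

text \<open>
  \<open>1 + y * v\<close> divides \<open>1 - (- (y * v)) ^ E\<close>, which is a unit.
\<close>

lemma in_radical_if_power:
  assumes y: "y \<in> V" and E: "y ^ E \<in> radical"
  shows "y \<in> radical"
proof -
  have "unit (1 + y * v)" if v: "v \<in> V" for v
  proof -
    let ?z = "- (y * v)"
    define S where "S = (\<Sum>i<E. ?z ^ i)"
    have z: "?z \<in> V" by (intro subring_uminus[OF V] subring_mult[OF V] y v)
    have S: "S \<in> V" unfolding S_def by (intro subring_sum[OF V] subring_power[OF V] z)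
    have "1 + y ^ E * (- ((- v) ^ E)) = 1 - ?z ^ E"
      by (simp add: power_mult_distrib[symmetric])
    also have "\<dots> = (1 + y * v) * S"
      unfolding S_def by (subst one_diff_power_eq) simp
    finally have "unit ((1 + y * v) * S)"
      using unit_one_plus[OF E, of "- ((- v) ^ E)"] subring_uminus[OF V] subring_power[OF V] v by auto
    then have w: "1 + y * v \<noteq> 0" "S \<noteq> 0" "inverse ((1 + y * v) * S) \<in> V"
      by (auto simp: unit_def)
    have "inverse (1 + y * v) = S * inverse ((1 + y * v) * S)"
      using w(1,2) by (simp add: mult.left_commute[of S])
    then have "inverse (1 + y * v) \<in> V"
      using subring_mult[OF V S w(3)] by metis
    then show ?thesis
      using w(1) y v unfolding unit_def
      by (auto intro!: subring_mult[OF V] subring_add[OF V] subring_one[OF V])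
  qed
  then show ?thesis using y by (simp add: radical_def)
qed

lemma one_not_in_radical: "1 \<notin> radical"
proof
  assume "1 \<in> radical"
  then have "unit (1 + 1 * - 1)" by (rule unit_one_plus) (intro subring_uminus[OF V] subring_one[OF V])
  then show False by (simp add: unit_def)
qed

text \<open>
  On \<open>D\<close> the valuation takes only integral multiples of the value of \<open>z\<close>.
\<close>

definition uniformizes :: "'a \<Rightarrow> 'a set \<Rightarrow> bool" where
  "uniformizes z D \<longleftrightarrow> (\<forall>x\<in>D. x \<noteq> 0 \<longrightarrow> (\<exists>k u. unit u \<and> x = z powi k * u))"

lemma power_int_unit_diff:
  assumes "a \<noteq> 0" "x = a powi k * u" "y = a powi l * w" "unit u" "unit w"
  shows "\<exists>n u. unit u \<and> x / y = a powi n * u"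
proof (intro exI conjI)
  show "unit (u * inverse w)" using assms by (intro unit_mult unit_inverse)
  show "x / y = a powi (k - l) * (u * inverse w)"
    using assms unit_nonzero[of w] by (simp add: power_int_diff divide_simps)
qed

text \<open>
  A nonzero element of \<open>F(\<theta>)\<close> is a quotient of two polynomials in
  \<open>\<theta>\<close>, and a polynomial with nonzero constant coefficient takes a unit value at
  \<open>\<theta>\<close>.
\<close>

lemma theta_uniformizes: "uniformizes \<theta> (rat_K F \<theta>)"
proof -
  let ?P = "\<lambda>p. \<forall>i. coeff p i \<in> F"
  let ?K = "{poly p \<theta> / poly s \<theta> | p s. ?P p \<and> ?P s \<and> poly s \<theta> \<noteq> 0}"
  have F: "is_subring F" using subfield by (simp add: is_subring_def is_subfield_def)
  have P: "?P (p - s)" "?P (p * s)" if "?P p" "?P s" for p s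
    using that subring_diff[OF F] subring_coeff_mult[OF F] by auto
  have const: "?P [:c:]" if "c \<in> F" for c
    using that zero_mem by (auto simp: coeff_pCons split: nat.split)
  have "is_subfield ?K"
    unfolding is_subfield_def
  proof (intro conjI ballI)
    show "0 \<in> ?K"
      using const[OF zero_mem] const[OF one_mem]
      by (intro CollectI exI[of _ "[:0:]"] exI[of _ "[:1:]"]) simp
    show "1 \<in> ?K"
      using const[OF one_mem] by (intro CollectI exI[of _ "[:1:]"]) simp
  next
    fix a b assume "a \<in> ?K" "b \<in> ?K"
    then obtain p s p' s' where *: "a = poly p \<theta> / poly s \<theta>" "?P p" "?P s" "poly s \<theta> \<noteq> 0"
      "b = poly p' \<theta> / poly s' \<theta>" "?P p'" "?P s'" "poly s' \<theta> \<noteq> 0"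
      by blast
    have "a - b = poly (p * s' - p' * s) \<theta> / poly (s * s') \<theta>"
      "a * b = poly (p * p') \<theta> / poly (s * s') \<theta>" "poly (s * s') \<theta> \<noteq> 0"
      using *(4,8) unfolding *(1,5) by (simp_all add: diff_frac_eq)
    moreover have "?P (p * s' - p' * s)" "?P (p * p')" "?P (s * s')"
      by (intro P *)+
    ultimately show "a - b \<in> ?K" "a * b \<in> ?K" by (blast, blast)
  next
    fix a assume "a \<in> ?K"
    then obtain p s where *: "a = poly p \<theta> / poly s \<theta>" "?P p" "?P s" "poly s \<theta> \<noteq> 0" by blast
    show "inverse a \<in> ?K"
    proof (cases "poly p \<theta> = 0")
      case True
      then have "inverse a = a" using *(1) by simp
      then show ?thesis using \<open>a \<in> ?K\<close> by simp
    next
      case False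
      have "inverse a = poly s \<theta> / poly p \<theta>" using *(1) by simp
      then show ?thesis using False *(2,3) by blast
    qed
  qed
  moreover have "insert \<theta> F \<subseteq> ?K"
  proof
    fix x assume "x \<in> insert \<theta> F"
    then obtain p where "?P p" "poly p \<theta> = x"
    proof (elim insertE)
      assume "x = \<theta>"
      moreover have "?P (monom 1 1)" using zero_mem one_mem by simp
      ultimately show ?thesis using that[of "monom 1 1"] by (simp add: poly_monom)
    qed (use that const in force)
    then show "x \<in> ?K"
      using const[OF one_mem] by (intro CollectI exI[of _ p] exI[of _ "[:1:]"]) simp
  qed
  ultimately have K: "rat_K F \<theta> \<subseteq> ?K"
    unfolding rat_K_def adjoin_def by (intro hull_minimal)
  have step: "\<exists>k u. unit u \<and> poly p \<theta> = \<theta> powi k * u" if "?P p" "p \<noteq> 0" for p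
    using that
  proof (induction p)
    case (pCons a p)
    have a: "a \<in> F" using spec[OF pCons.prems(1), of 0] by simp
    have p: "coeff p i \<in> F" for i using spec[OF pCons.prems(1), of "Suc i"] by simp
    show ?case
    proof (cases "a = 0")
      case True
      then have "p \<noteq> 0" using pCons.prems by auto
      then obtain k u where "unit u" "poly p \<theta> = \<theta> powi k * u"
        using pCons.IH p by blast
      then show ?thesis
        using True theta_nonzero
        by (intro exI[of _ "k + 1"] exI[of _ u]) (simp add: power_int_add)
    next
      case False
      have "poly p \<theta> \<in> V"
        using p constants theta_mem by (intro subring_poly[OF V]) auto
      then have "unit (a + \<theta> * poly p \<theta>)"
        by (intro unit_add_radical unit_constant a False radical_mult theta_in_radical)
      then show ?thesis by (intro exI[of _ 0] exI[of _ "a + \<theta> * poly p \<theta>"]) simp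
    qed
  qed simp
  have poly: "\<exists>k u. unit u \<and> poly p \<theta> = \<theta> powi k * u" if "?P p" "poly p \<theta> \<noteq> 0" for p
  proof -
    have "p \<noteq> 0" using that(2) by auto
    then show ?thesis using step[OF that(1)] by simp
  qed
  have val: "\<exists>k u. unit u \<and> x = \<theta> powi k * u" if x: "x \<in> ?K" "x \<noteq> 0" for x
  proof -
    obtain p s where *: "x = poly p \<theta> / poly s \<theta>" "?P p" "?P s" "poly s \<theta> \<noteq> 0"
      using x(1) by blast
    moreover from this have "poly p \<theta> \<noteq> 0" using x(2) by auto
    ultimately obtain k u l w where "poly p \<theta> = \<theta> powi k * u" "unit u"
      "poly s \<theta> = \<theta> powi l * w" "unit w"
      using poly by metis
    then show ?thesis unfolding *(1) by (intro power_int_unit_diff[OF theta_nonzero])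
  qed
  show ?thesis
    unfolding uniformizes_def by (intro ballI impI) (rule val[OF subsetD[OF K]])
qed

text \<open>
  The term of least valuation dominates the sum.
\<close>

lemma sum_distinct_valuations:
  assumes z: "z \<in> radical" "z \<noteq> 0" and I: "finite I" "I \<noteq> {}"
    and u: "\<And>i. i \<in> I \<Longrightarrow> unit (u i)" and e: "inj_on e I"
  shows "\<exists>k w. unit w \<and> (\<Sum>i\<in>I. z powi e i * u i) = z powi k * w"
proof -
  obtain i where i: "i \<in> I" "\<And>j. j \<in> I \<Longrightarrow> e i \<le> e j"
    using ex_min_if_finite[of "e ` I"] I by (auto simp: not_less)
  have "z powi (e j - e i) * u j \<in> radical" if j: "j \<in> I - {i}" for j
  proof -
    have "e i < e j"
      using j i e by (metis DiffE insertI1 inj_on_eq_iff order_le_less)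
    then have "z powi (e j - e i) = z ^ nat (e j - e i)" "nat (e j - e i) > 0"
      by (auto simp: power_int_def)
    then show ?thesis using radical_power[OF z(1)] radical_mult unit_mem u j by auto
  qed
  then have "unit (u i + (\<Sum>j\<in>I - {i}. z powi (e j - e i) * u j))"
    by (intro unit_add_radical u i radical_sum)
  moreover have "(\<Sum>j\<in>I. z powi e j * u j)
      = z powi e i * (u i + (\<Sum>j\<in>I - {i}. z powi (e j - e i) * u j))"
    using I(1) i(1) z(2)
    by (simp add: sum.remove distrib_left sum_distrib_left power_int_diff mult.assoc[symmetric])
  ultimately show ?thesis by blast
qed

text \<open>
  The Eisenstein argument: the value of \<open>y\<close> is the \<open>d\<close>-th part of the value
  of \<open>z\<close>, so the terms of a polynomial of degree less than \<open>d\<close> have values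
  in distinct residue classes modulo \<open>d\<close>. In particular \<open>y\<close> satisfies no
  equation of degree less than \<open>d\<close>.
\<close>

lemma poly_valuation:
  assumes D: "uniformizes z D" and y: "y \<in> radical" "y \<noteq> 0"
    and d: "d > 0" "y ^ d = z * u" "unit u"
    and p: "p \<noteq> 0" "\<And>i. coeff p i \<in> D" "degree p < d"
  shows "\<exists>k w. unit w \<and> poly p y = y powi k * w"
proof -
  define I where "I = {i. i \<le> degree p \<and> coeff p i \<noteq> 0}"
  have "\<exists>k w. unit w \<and> coeff p i = y powi (int d * k) * w" if i: "i \<in> I" for i
  proof -
    have "coeff p i \<noteq> 0" using i unfolding I_def by simp
    then obtain k w where w: "unit w" "coeff p i = z powi k * w"
      using D p(2) unfolding uniformizes_def by blast
    have "z = y powi int d * inverse u" using d(2) unit_nonzero[OF d(3)] by simp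
    then have "z powi k = (y powi int d * inverse u) powi k" by (rule arg_cong)
    also have "\<dots> = y powi (int d * k) * inverse u powi k"
      by (simp only: power_int_mult_distrib power_int_mult)
    finally have "z powi k = y powi (int d * k) * inverse u powi k" .
    then show ?thesis
      using w by (intro exI[of _ k] exI[of _ "inverse u powi k * w"])
        (simp add: unit_mult unit_power_int unit_inverse d(3))
  qed
  then obtain k w where kw: "\<And>i. i \<in> I \<Longrightarrow> unit (w i)"
    "\<And>i. i \<in> I \<Longrightarrow> coeff p i = y powi (int d * k i) * w i"
    by metis
  have "inj_on (\<lambda>i. int d * k i + int i) I"
  proof (rule inj_onI)
    fix i j assume ij: "i \<in> I" "j \<in> I" "int d * k i + int i = int d * k j + int j"
    have "(int d * k i + int i) mod int d = (int d * k j + int j) mod int d"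
      by (simp only: ij(3))
    then have "int i mod int d = int j mod int d" by simp
    moreover have "i < d" "j < d" using ij(1,2) p(3) by (auto simp: I_def)
    ultimately show "i = j" by simp
  qed
  moreover have "finite I" "I \<noteq> {}"
    using p(1) by (auto simp: I_def intro: exI[of _ "degree p"])
  ultimately have "\<exists>l v. unit v \<and> (\<Sum>i\<in>I. y powi (int d * k i + int i) * w i) = y powi l * v"
    using kw(1) by (intro sum_distinct_valuations y)
  moreover have "poly p y = (\<Sum>i\<in>I. coeff p i * y ^ i)"
    unfolding poly_altdef by (intro sum.mono_neutral_right) (auto simp: I_def)
  moreover have "\<dots> = (\<Sum>i\<in>I. y powi (int d * k i + int i) * w i)"
    using y(2) kw(2) by (intro sum.cong) (simp_all add: power_int_add)
  ultimately show ?thesis by simp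
qed

text \<open>
  One step of a totally ramified tower: any root of the image of \<open>f\<close> is allowed as the
  image of \<open>y\<close>, and \<open>y\<close> takes over the role of \<open>z\<close>.
\<close>

lemma adjoin_ramified_root:
  assumes r: "partial_hom r" and D: "uniformizes z (Domain r)"
    and y: "y \<in> radical" "y \<noteq> 0" and d: "d > 0" "y ^ d = z * u" "unit u"
    and f: "polrel r f f'" "degree f = d" "poly f y = 0" "poly f' y' = 0"
  shows "partial_hom (adjoin_root r y y')" "uniformizes y (Domain (adjoin_root r y y'))"
proof -
  have f0: "f \<noteq> 0" using f(2) d(1) by auto
  have val: "\<exists>k w. unit w \<and> poly p y = y powi k * w"
    if "p \<noteq> 0" "\<And>i. coeff p i \<in> Domain r" "degree p < d" for p
    using that by (intro poly_valuation[OF D y d])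
  have nonzero: "poly p y \<noteq> 0"
    if "p \<noteq> 0" "\<And>i. coeff p i \<in> Domain r" "degree p < d" for p
    using val[OF that] y(2) unit_nonzero by auto
  show "partial_hom (adjoin_root r y y')"
    using nonzero f(2) by (intro partial_hom_adjoin_root[OF r f(1) f0 f(3,4)]) (meson not_less)
  show "uniformizes y (Domain (adjoin_root r y y'))"
    unfolding uniformizes_def
  proof (intro ballI impI)
    fix x assume "x \<in> Domain (adjoin_root r y y')" and x: "x \<noteq> 0"
    then obtain p p' where p: "polrel r p p'" "x = poly p y" by (auto simp: adjoin_root_def)
    obtain h h' s s' where s: "polrel r s s'" "p = f * h + s" "s = 0 \<or> degree s < degree f"
      using polrel_divide[OF r f(1) f0 p(1)] by blast
    have xs: "x = poly s y" using p(2) s(2) f(3) by simp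
    then have "s \<noteq> 0" using x by auto
    moreover have "coeff s i \<in> Domain r" for i using s(1) by (auto simp: polrel_def)
    ultimately show "\<exists>k u. unit u \<and> x = y powi k * u"
      unfolding xs using s(3) f(2) by (intro val) auto
  qed
qed

end

section \<open>Conjugacy of Carlitz torsion points\<close>

text \<open>
  The homomorphism with \<open>w n \<mapsto> w' n\<close> on the fields generated by the first torsion
  points.
\<close>

primrec torsion_tower :: "'a::field set \<Rightarrow> (nat \<Rightarrow> 'a) \<Rightarrow> (nat \<Rightarrow> 'a) \<Rightarrow> nat \<Rightarrow> ('a \<times> 'a) set" where
  "torsion_tower K w w' 0 = adjoin_root (Id_on K) (w 0) (w' 0)"
| "torsion_tower K w w' (Suc n) = adjoin_root (torsion_tower K w w' n) (w (Suc n)) (w' (Suc n))"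

context carlitz
begin

text \<open>
  Compatible systems of torsion points of the Carlitz module
  \<open>C\<^sub>\<theta>(x) = \<theta> * x + x ^ q\<close>: \<open>w n\<close> is annihilated by
  \<open>\<theta> ^ (n + 1)\<close> and \<open>C\<^sub>\<theta>(w (n + 1)) = w n\<close>, starting
  from a nonzero root of \<open>C\<^sub>\<theta>\<close>.
\<close>

definition torsion_sequence :: "(nat \<Rightarrow> 'c) \<Rightarrow> bool" where
  "torsion_sequence w \<longleftrightarrow> w 0 ^ (card F - 1) = - \<theta> \<and>
     (\<forall>n. w (Suc n) ^ card F + \<theta> * w (Suc n) = w n)"

end

context carlitz_valuation
begin

text \<open>
  If \<open>y\<close> were not in \<open>V\<close>, the equation divided by \<open>y ^ q\<close> would
  put \<open>1\<close> into the radical. Then \<open>\<theta> * y\<close> is of larger value than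
  \<open>z\<close>, since \<open>z\<close> divides \<open>\<theta>\<close>, so \<open>y ^ q\<close>
  and \<open>z\<close> differ by a unit.
\<close>

lemma torsion_step:
  assumes z: "z \<in> radical" "z \<noteq> 0" "E > 0" "z ^ E = \<theta> * u" "unit u"
    and y: "y ^ card F + \<theta> * y = z"
  shows "y \<in> radical" "y \<noteq> 0" "\<exists>v. unit v \<and> y ^ card F = z * v \<and> y ^ (card F * E) = \<theta> * (u * v ^ E)"
proof -
  have q: "card F > 0" using card_ge_2 by simp
  show y0: "y \<noteq> 0" using y z(2) q by (auto simp: zero_power)
  have yV: "y \<in> V"
  proof (rule ccontr)
    assume "y \<notin> V"
    then have i: "inverse y \<in> V" using valuation by blast
    have "y * inverse y ^ card F = inverse y ^ (card F - 1)"
      using y0 q by (cases "card F") simp_all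
    then have "inverse y ^ card F * (y ^ card F + \<theta> * y) = 1 + \<theta> * inverse y ^ (card F - 1)"
      using y0
      by (simp add: distrib_left power_mult_distrib[symmetric] mult_ac)
    then have "1 = z * inverse y ^ card F + \<theta> * (- (inverse y ^ (card F - 1)))"
      unfolding y by (simp add: mult.commute)
    moreover have "\<dots> \<in> radical"
      by (intro radical_add radical_mult z(1) theta_in_radical subring_uminus[OF V]
          subring_power[OF V] i)
    ultimately show False using one_not_in_radical by simp
  qed
  have "z + \<theta> * (- y) \<in> radical"
    by (intro radical_add radical_mult z(1) theta_in_radical subring_uminus[OF V] yV)
  moreover have "y ^ card F = z + \<theta> * (- y)" using y by (simp add: algebra_simps)
  ultimately have "y ^ card F \<in> radical" by simp
  then show yr: "y \<in> radical" using yV by (rule in_radical_if_power[rotated])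
  let ?v = "1 + y * (- (z ^ (E - 1) * inverse u))"
  have v: "unit ?v"
    by (intro unit_one_plus yr subring_uminus[OF V] subring_mult[OF V] subring_power[OF V]
        radical_mem z(1) unit_mem unit_inverse z(5))
  have "\<theta> = z ^ E * inverse u" using z(4) unit_nonzero[OF z(5)] by simp
  also have "\<dots> = z * (z ^ (E - 1) * inverse u)"
    using z(3) by (simp add: power_eq_if)
  finally have t: "\<theta> = z * (z ^ (E - 1) * inverse u)" .
  have "y ^ card F = z - \<theta> * y" using y by (simp add: algebra_simps)
  also have "\<dots> = z * ?v" by (subst t) (simp add: algebra_simps)
  finally have yq: "y ^ card F = z * ?v" .
  have "y ^ (card F * E) = (z * ?v) ^ E" by (simp only: power_mult yq)
  also have "\<dots> = \<theta> * (u * ?v ^ E)" by (simp add: power_mult_distrib z(4))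
  finally show "\<exists>v. unit v \<and> y ^ card F = z * v \<and> y ^ (card F * E) = \<theta> * (u * v ^ E)"
    using v yq by blast
qed

lemma torsion_sequence_radical:
  assumes "torsion_sequence w"
  shows "w n \<in> radical \<and> w n \<noteq> 0 \<and> (\<exists>E>0. \<exists>u. unit u \<and> w n ^ E = \<theta> * u)"
proof (induction n)
  case 0
  have q: "card F - 1 > 0" using card_ge_2 by simp
  have w0: "w 0 ^ (card F - 1) = - \<theta>" using assms by (simp add: torsion_sequence_def)
  then have nz: "w 0 \<noteq> 0" using theta_nonzero q by (auto simp: zero_power)
  have "w 0 \<in> V"
  proof (rule ccontr)
    assume "w 0 \<notin> V"
    then have i: "inverse (w 0) \<in> V" using valuation by blast
    have "1 = inverse (w 0) ^ (card F - 1) * w 0 ^ (card F - 1)"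
      using nz by (simp add: power_mult_distrib[symmetric])
    also have "\<dots> = \<theta> * (- (inverse (w 0) ^ (card F - 1)))"
      unfolding w0 by simp
    finally have "1 = \<theta> * (- (inverse (w 0) ^ (card F - 1)))" .
    moreover have "\<dots> \<in> radical"
      by (intro radical_mult theta_in_radical subring_uminus[OF V] subring_power[OF V] i)
    ultimately show False using one_not_in_radical by simp
  qed
  moreover have "w 0 ^ (card F - 1) \<in> radical"
    unfolding w0 using radical_mult[OF theta_in_radical subring_uminus[OF V subring_one[OF V]]] by simp
  ultimately have "w 0 \<in> radical" by (rule in_radical_if_power)
  then show ?case
    using nz q w0 unit_uminus[OF unit_one]
    by (intro conjI exI[of _ "card F - 1"] exI[of _ "- 1"]) auto
next
  case (Suc n)
  then obtain E u where E: "E > 0" "unit u" "w n ^ E = \<theta> * u" by blast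
  note step = torsion_step[OF _ _ E(1,3,2), of "w (Suc n)"]
  have rec: "w (Suc n) ^ card F + \<theta> * w (Suc n) = w n"
    using assms by (simp add: torsion_sequence_def)
  obtain v where "unit v" "w (Suc n) ^ (card F * E) = \<theta> * (u * v ^ E)"
    using step(3) Suc rec by blast
  moreover have "card F * E > 0" using E(1) card_ge_2 by simp
  ultimately show ?case
    using step(1,2) Suc rec unit_mult[OF E(2) unit_power[of v E]] by blast
qed

text \<open>
  The extension is totally ramified of degree \<open>q - 1\<close> at the first step and of degree
  \<open>q\<close> at each further one, so the Carlitz equations have minimal degree and the images
  can be prescribed.
\<close>

lemma torsion_tower:
  assumes w: "torsion_sequence w" and w': "torsion_sequence w'"
  defines "r \<equiv> torsion_tower (rat_K F \<theta>) w w'"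
  shows "partial_hom (r n) \<and> uniformizes (w n) (Domain (r n)) \<and> (w n, w' n) \<in> r n
    \<and> Id_on (rat_K F \<theta>) \<subseteq> r n"
proof -
  let ?K = "rat_K F \<theta>"
  have K: "partial_hom (Id_on ?K)"
    unfolding rat_K_def adjoin_def by (intro partial_hom_Id_on is_subfield_hull)
  have theta: "(\<theta>, \<theta>) \<in> Id_on ?K"
    unfolding rat_K_def adjoin_def by (auto intro: hull_inc)
  have q: "card F - 1 > 0" "card F > 1" using card_ge_2 by simp_all
  show ?thesis
  proof (induction n)
    case 0
    let ?f = "monom 1 (card F - 1) + [:\<theta>:]"
    have f: "polrel (Id_on ?K) ?f ?f"
      by (intro polrel_add[OF K] polrel_monom[OF K] polrel_const[OF K] partial_hom_one[OF K] theta)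
    have deg: "degree ?f = card F - 1"
      using q by (subst degree_add_eq_left) (simp_all add: degree_monom_eq)
    have w0: "w 0 ^ (card F - 1) = \<theta> * - 1" "w' 0 ^ (card F - 1) = \<theta> * - 1"
      using w w' by (simp_all add: torsion_sequence_def)
    have "uniformizes \<theta> (Domain (Id_on ?K))" using theta_uniformizes by simp
    note adjoin_ramified_root[OF K this _ _ q(1) w0(1) unit_uminus[OF unit_one] f deg, of "w' 0"]
    then show ?case
      using torsion_sequence_radical[OF w, of 0] w0 adjoin_root_mono[OF K]
        adjoin_root_generator[OF K]
      unfolding r_def by (simp add: poly_monom)
  next
    case (Suc n)
    then have r: "partial_hom (r n)" and D: "uniformizes (w n) (Domain (r n))"
      and rw: "(w n, w' n) \<in> r n" and Kr: "Id_on ?K \<subseteq> r n" by simp_all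
    let ?f = "\<lambda>w. monom 1 (card F) + (monom \<theta> 1 - [:w n:])"
    have f: "polrel (r n) (?f w) (?f w')"
      using Kr theta by (intro polrel_add[OF r] polrel_diff[OF r] polrel_monom[OF r]
          polrel_const[OF r] partial_hom_one[OF r] rw) auto
    have "degree (monom \<theta> 1 - [:w n:]) \<le> 1"
      by (intro degree_diff_le) (simp_all add: degree_monom_le)
    then have deg: "degree (?f w) = card F"
      using q by (subst degree_add_eq_left) (simp_all add: degree_monom_eq)
    have rec: "w (Suc n) ^ card F + \<theta> * w (Suc n) = w n"
      "w' (Suc n) ^ card F + \<theta> * w' (Suc n) = w' n"
      using w w' by (simp_all add: torsion_sequence_def)
    then have roots: "poly (?f w) (w (Suc n)) = 0" "poly (?f w') (w' (Suc n)) = 0"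
      by (simp_all add: poly_monom add_diff_eq)
    obtain E u where E: "E > 0" "unit u" "w n ^ E = \<theta> * u"
      using torsion_sequence_radical[OF w, of n] by blast
    obtain v where v: "unit v" "w (Suc n) ^ card F = w n * v"
      using torsion_step(3)[OF _ _ E(1,3,2) rec(1)] torsion_sequence_radical[OF w, of n] by blast
    have wr: "w (Suc n) \<in> radical" "w (Suc n) \<noteq> 0"
      using torsion_sequence_radical[OF w, of "Suc n"] by simp_all
    have "card F > 0" using q by simp
    from adjoin_ramified_root[OF r D wr this v(2,1) f deg roots]
    show ?case
      using Kr adjoin_root_mono[OF r] adjoin_root_generator[OF r] unfolding r_def by auto
  qed
qed

end

context carlitz
begin

text \<open>
  Any two compatible systems of torsion points are conjugate over \<open>F(\<theta>)\<close>. This is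
  the surjectivity of the Galois representation on the Carlitz-Tate module at \<open>\<theta>\<close>.
\<close>

lemma torsion_partial_hom:
  assumes w: "torsion_sequence w" and w': "torsion_sequence w'"
    and L: "is_subfield L" "rat_K F \<theta> \<subseteq> L" "range w \<subseteq> L" "range w' \<subseteq> L"
  shows "\<exists>r. partial_hom r \<and> Id_on (rat_K F \<theta>) \<subseteq> r \<and> r \<subseteq> L \<times> L \<and> (\<forall>n. (w n, w' n) \<in> r)"
proof -
  obtain V where "carlitz_valuation F \<theta> V"
    using valuation_ring_exists carlitz_axioms
    by (auto simp: carlitz_valuation_def carlitz_valuation_axioms_def)
  then interpret carlitz_valuation F \<theta> V .
  let ?r = "torsion_tower (rat_K F \<theta>) w w'"
  have r: "partial_hom (?r n)" "(w n, w' n) \<in> ?r n" "Id_on (rat_K F \<theta>) \<subseteq> ?r n" for n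
    using torsion_tower[OF w w', of n] by simp_all
  have "?r n \<subseteq> ?r (Suc n)" for n
    using adjoin_root_mono[OF r(1)] by simp
  then have mono: "?r m \<subseteq> ?r n" if "m \<le> n" for m n
    using that by (rule lift_Suc_mono_le)
  have sub: "?r n \<subseteq> L \<times> L" for n
  proof (induction n)
    case 0
    have "Id_on (rat_K F \<theta>) \<subseteq> L \<times> L" using L(2) by auto
    then show ?case using L by (simp add: adjoin_root_subset range_subsetD)
  next
    case (Suc n)
    then show ?case using L by (simp add: adjoin_root_subset range_subsetD)
  qed
  have "partial_hom (\<Union>(range ?r))"
    using r(1) mono by (intro partial_hom_Union) (auto, metis nle_le subsetD)
  then show ?thesis
    using r sub by (intro exI[of _ "\<Union>(range ?r)"]) blast
qed

end

section \<open>Conjugates of Laurent series\<close>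

definition fls_rel :: "('a::field \<times> 'a) set \<Rightarrow> 'a fls \<Rightarrow> 'a fls \<Rightarrow> bool" where
  "fls_rel r f g \<longleftrightarrow> (\<forall>i. (fls_nth f i, fls_nth g i) \<in> r)"

context
  fixes r :: "('a::field \<times> 'a) set"
  assumes r: "partial_hom r"
begin

lemma fls_rel_diff: "fls_rel r f f' \<Longrightarrow> fls_rel r g g' \<Longrightarrow> fls_rel r (f - g) (f' - g')"
  by (simp add: fls_rel_def partial_hom_diff[OF r])

lemma fls_rel_add: "fls_rel r f f' \<Longrightarrow> fls_rel r g g' \<Longrightarrow> fls_rel r (f + g) (f' + g')"
  by (simp add: fls_rel_def partial_hom_add[OF r])

lemma fls_rel_const: "(c, c') \<in> r \<Longrightarrow> fls_rel r (fls_const c) (fls_const c')"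
  by (simp add: fls_rel_def partial_hom_zero[OF r])

lemma fls_rel_zero: "fls_rel r 0 0"
  by (simp add: fls_rel_def partial_hom_zero[OF r])

lemma fls_rel_one: "fls_rel r 1 1"
  using fls_rel_const[OF partial_hom_one[OF r]] by simp

lemma fls_rel_X: "fls_rel r fls_X fls_X"
  by (simp add: fls_rel_def partial_hom_zero[OF r] partial_hom_one[OF r])

lemma fls_rel_unique: "fls_rel r f g \<Longrightarrow> fls_rel r f h \<Longrightarrow> g = h"
  using partial_hom_unique[OF r] unfolding fls_rel_def by (intro fls_eqI) blast

lemma fls_rel_nth_eq_0_iff: "fls_rel r f g \<Longrightarrow> fls_nth f i = 0 \<longleftrightarrow> fls_nth g i = 0"
  unfolding fls_rel_def by (rule partial_hom_eq_0_iff[OF r]) blast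

lemma fls_rel_eq_0_iff: "fls_rel r f g \<Longrightarrow> f = 0 \<longleftrightarrow> g = 0"
  unfolding fls_eq_iff by (simp add: fls_rel_nth_eq_0_iff)

lemma fls_rel_subdegree:
  assumes "fls_rel r f g"
  shows "fls_subdegree g = fls_subdegree f"
proof (cases "f = 0")
  case True
  then show ?thesis using fls_rel_eq_0_iff[OF assms] by simp
next
  case False
  then show ?thesis
    using fls_rel_nth_eq_0_iff[OF assms, symmetric] by (intro fls_subdegree_eqI) simp_all
qed

lemma fls_rel_mult:
  assumes "fls_rel r f f'" "fls_rel r g g'"
  shows "fls_rel r (f * g) (f' * g')"
  using assms unfolding fls_rel_def fls_times_nth(2)
    fls_rel_subdegree[OF assms(1)] fls_rel_subdegree[OF assms(2)]
  by (intro allI partial_hom_sum[OF r] partial_hom_mult[OF r]) blast+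

lemma fls_rel_power: "fls_rel r f g \<Longrightarrow> fls_rel r (f ^ n) (g ^ n)"
  by (induction n) (auto intro: fls_rel_one fls_rel_mult)

lemma fls_rel_sum: "(\<And>i. i \<in> I \<Longrightarrow> fls_rel r (f i) (g i)) \<Longrightarrow> fls_rel r (sum f I) (sum g I)"
  by (induction I rule: infinite_finite_induct) (auto intro: fls_rel_zero fls_rel_add)

lemma fls_rel_prod: "(\<And>i. i \<in> I \<Longrightarrow> fls_rel r (f i) (g i)) \<Longrightarrow> fls_rel r (prod f I) (prod g I)"
  by (induction I rule: infinite_finite_induct) (auto intro: fls_rel_one fls_rel_mult)

lemma fls_rel_hyperderiv: "fls_rel r f g \<Longrightarrow> fls_rel r (hyperderiv n f) (hyperderiv n g)"
  by (simp add: fls_rel_def fls_nth_hyperderiv partial_hom_mult[OF r] partial_hom_of_int[OF r])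

lemma is_subfield_Domain: "is_subfield (Domain r)"
  unfolding is_subfield_def
proof (intro conjI ballI)
  fix x y assume "x \<in> Domain r" "y \<in> Domain r"
  then show "x - y \<in> Domain r" "x * y \<in> Domain r"
    using partial_hom_diff[OF r] partial_hom_mult[OF r] by blast+
qed (use partial_hom_zero[OF r] partial_hom_one[OF r] partial_hom_inverse[OF r] in blast)+

end

lemma fps_inverse_coefficients:
  assumes S: "is_subfield S" and f: "\<And>i. fps_nth f i \<in> S" "fps_nth f 0 \<noteq> 0"
  shows "fps_nth (inverse f) n \<in> S"
proof (induction n rule: less_induct)
  case (less n)
  have r: "partial_hom (Id_on S)" using S by (rule partial_hom_Id_on)
  define c where "c = (\<Sum>i=1..n. fps_nth f i * fps_nth (inverse f) (n - i))"
  have "f * inverse f = 1" using f(2) by (simp add: inverse_mult_eq_1')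
  then have "fps_nth 1 n = (\<Sum>i=0..n. fps_nth f i * fps_nth (inverse f) (n - i))"
    by (simp add: fps_mult_nth[symmetric])
  also have "\<dots> = fps_nth f 0 * fps_nth (inverse f) n + c"
    by (simp add: c_def sum.atLeast_Suc_atMost)
  finally have eq: "fps_nth (inverse f) n = inverse (fps_nth f 0) * (fps_nth 1 n - c)"
    using f(2) by (simp add: field_simps)
  have "(c, c) \<in> Id_on S"
    unfolding c_def using f(1) less
    by (intro partial_hom_sum[OF r] partial_hom_mult[OF r]) auto
  moreover have "(fps_nth 1 n, fps_nth 1 n) \<in> Id_on S"
    using partial_hom_zero[OF r] partial_hom_one[OF r] by simp
  ultimately have "(fps_nth (inverse f) n, fps_nth (inverse f) n) \<in> Id_on S"
    unfolding eq using f(1)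
    by (intro partial_hom_mult[OF r] partial_hom_diff[OF r] partial_hom_inverse[OF r]) auto
  then show ?case by auto
qed

text \<open>
  The coefficients of the inverse are determined recursively by field operations.
\<close>

lemma fls_inverse_coefficients:
  assumes S: "is_subfield S" and f: "\<And>i. fls_nth f i \<in> S" "f \<noteq> 0"
  shows "fls_nth (inverse f) n \<in> S"
proof -
  have "fps_nth (inverse (fls_base_factor_to_fps f)) k \<in> S" for k
    using f by (intro fps_inverse_coefficients S) auto
  moreover have "0 \<in> S" using S by (simp add: is_subfield_def)
  ultimately show ?thesis by (simp add: fls_inverse_def)
qed

text \<open>
  The first condition rules out series on which some homomorphism in \<open>G\<close> is undefined; a
  sum of such series could have conjugates that do not come from conjugates of the summands.
\<close>

definition finitely_many_conjugates :: "('a::field \<times> 'a) set set \<Rightarrow> 'a fls \<Rightarrow> bool" where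
  "finitely_many_conjugates G f \<longleftrightarrow>
     (\<forall>r\<in>G. \<exists>g. fls_rel r f g) \<and> finite {g. \<exists>r\<in>G. fls_rel r f g}"

text \<open>
  The conjugates of a sum, product or inverse are among the sums, products or inverses of the
  conjugates.
\<close>

lemma is_subfield_finitely_many_conjugates:
  fixes G :: "('a::field \<times> 'a) set set"
  assumes G: "\<And>r. r \<in> G \<Longrightarrow> partial_hom r"
  shows "is_subfield {f. finitely_many_conjugates G f}"
proof -
  let ?C = "\<lambda>f. {g. \<exists>r\<in>G. fls_rel r f g}"
  have binary: "finitely_many_conjugates G (h f g)"
    if fg: "finitely_many_conjugates G f" "finitely_many_conjugates G g"
      and h: "\<And>r f f' g g'. r \<in> G \<Longrightarrow> fls_rel r f f' \<Longrightarrow> fls_rel r g g' \<Longrightarrow> fls_rel r (h f g) (h f' g')"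
    for f g and h :: "'a fls \<Rightarrow> 'a fls \<Rightarrow> 'a fls"
  proof -
    have ex: "\<exists>f' g'. fls_rel r f f' \<and> fls_rel r g g'" if "r \<in> G" for r
      using fg that by (auto simp: finitely_many_conjugates_def)
    have "?C (h f g) \<subseteq> (\<lambda>(a, b). h a b) ` (?C f \<times> ?C g)"
    proof
      fix k assume "k \<in> ?C (h f g)"
      then obtain r where r: "r \<in> G" "fls_rel r (h f g) k" by blast
      then obtain f' g' where "fls_rel r f f'" "fls_rel r g g'" using ex by blast
      moreover from this have "k = h f' g'"
        using h[OF r(1)] r(2) fls_rel_unique[OF G[OF r(1)]] by blast
      ultimately show "k \<in> (\<lambda>(a, b). h a b) ` (?C f \<times> ?C g)" using r(1) by auto
    qed
    moreover have "finite ((\<lambda>(a, b). h a b) ` (?C f \<times> ?C g))"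
      using fg by (auto simp: finitely_many_conjugates_def)
    ultimately have "finite (?C (h f g))" by (rule finite_subset)
    then show ?thesis using ex h unfolding finitely_many_conjugates_def by blast
  qed
  have const: "finitely_many_conjugates G f" if "\<And>r. r \<in> G \<Longrightarrow> fls_rel r f f" for f
  proof -
    have "?C f \<subseteq> {f}" using that fls_rel_unique[OF G] by blast
    then show ?thesis
      using that finite_subset unfolding finitely_many_conjugates_def by blast
  qed
  have inverse: "finitely_many_conjugates G (inverse f)" if f: "finitely_many_conjugates G f" for f
  proof (cases "f = 0")
    case False
    have inv: "fls_rel r (inverse f) (inverse f')" if r: "r \<in> G" "fls_rel r f f'" for r f'
    proof -
      have "fls_nth (inverse f) i \<in> Domain r" for i
        using r False by (intro fls_inverse_coefficients is_subfield_Domain G)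
          (auto simp: fls_rel_def)
      \<comment> \<open>the image of \<open>inverse f\<close>, taken coefficientwise, multiplies \<open>f'\<close> to \<open>1\<close>\<close>
      then obtain c where c: "\<And>i. (fls_nth (inverse f) i, c i) \<in> r"
        using choice[of "\<lambda>i y. (fls_nth (inverse f) i, y) \<in> r"] by blast
      have "c i = 0" if "i < fls_subdegree (inverse f)" for i
        using c[of i] that partial_hom_zeroD[OF G[OF r(1)]] by simp
      then have "fls_nth (Abs_fls c) = c"
        by (intro ext nth_Abs_fls_lower_bound) auto
      then have rel: "fls_rel r (inverse f) (Abs_fls c)" using c by (simp add: fls_rel_def)
      have "fls_rel r (f * inverse f) (f' * Abs_fls c)"
        by (intro fls_rel_mult G r rel)
      then have "f' * Abs_fls c = 1"
        using False fls_rel_unique[OF G[OF r(1)] _ fls_rel_one[OF G[OF r(1)]]] by simp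
      then have "inverse f' = Abs_fls c" by (rule inverse_unique)
      then show ?thesis using rel by simp
    qed
    have ex: "\<exists>f'. fls_rel r f f'" if "r \<in> G" for r
      using f that by (auto simp: finitely_many_conjugates_def)
    have "?C (inverse f) \<subseteq> inverse ` ?C f"
      using inv ex fls_rel_unique[OF G] by blast
    then have "finite (?C (inverse f))"
      using f finite_subset[of _ "inverse ` ?C f"] by (auto simp: finitely_many_conjugates_def)
    then show ?thesis using inv ex unfolding finitely_many_conjugates_def by blast
  qed (use f in simp)
  show ?thesis
    unfolding is_subfield_def
    using const[of 0] const[of 1] inverse binary[of _ _ "(-)"] binary[of _ _ "(*)"]
      fls_rel_zero[OF G] fls_rel_one[OF G] fls_rel_diff[OF G] fls_rel_mult[OF G]
    by simp
qed

text \<open>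
  An element algebraic over \<open>K\<close> can only be mapped to the finitely many roots of its
  equation over \<open>K\<close>, and the series with finitely many conjugates form a field. This
  covers rational functions as well as polynomials.
\<close>

lemma ratfun_finitely_many_conjugates:
  assumes G: "\<And>r. r \<in> G \<Longrightarrow> partial_hom r" "\<And>r. r \<in> G \<Longrightarrow> Id_on K \<subseteq> r"
    and M: "\<And>r. r \<in> G \<Longrightarrow> M \<subseteq> Domain r" "\<And>x. x \<in> M \<Longrightarrow> algebraic_over K x"
    and f: "f \<in> ratfun_field M"
  shows "finitely_many_conjugates G f"
proof -
  have "finitely_many_conjugates G (fls_const c)" if c: "c \<in> M" for c
  proof -
    obtain p where p: "p \<noteq> 0" "\<And>i. coeff p i \<in> K" "poly p c = 0"
      using M(2)[OF c] by (auto simp: algebraic_over_def)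
    have ex: "\<exists>d. (c, d) \<in> r" if "r \<in> G" for r using M(1)[OF that] c by blast
    have "g \<in> fls_const ` {x. poly p x = 0}" if g: "r \<in> G" "fls_rel r (fls_const c) g" for r g
    proof -
      obtain d where d: "(c, d) \<in> r" using ex g(1) by blast
      have "polrel r p p" using p(2) G(2)[OF g(1)] by (auto simp: polrel_def)
      then have "(poly p c, poly p d) \<in> r" using d by (rule polrel_poly[OF G(1)[OF g(1)]])
      then have "poly p d = 0" using p(3) partial_hom_zeroD[OF G(1)[OF g(1)]] by simp
      moreover have "g = fls_const d"
        using fls_rel_unique[OF G(1)[OF g(1)] g(2) fls_rel_const[OF G(1)[OF g(1)] d]] .
      ultimately show ?thesis by blast
    qed
    then have "{g. \<exists>r\<in>G. fls_rel r (fls_const c) g} \<subseteq> fls_const ` {x. poly p x = 0}" by blast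
    then have "finite {g. \<exists>r\<in>G. fls_rel r (fls_const c) g}"
      using poly_roots_finite[OF p(1)] by (rule finite_subset[OF _ finite_imageI])
    then show ?thesis
      using ex fls_rel_const[OF G(1)] unfolding finitely_many_conjugates_def by blast
  qed
  moreover have "finitely_many_conjugates G fls_X"
  proof -
    have "{g. \<exists>r\<in>G. fls_rel r fls_X g} \<subseteq> {fls_X}"
      using fls_rel_X[OF G(1)] fls_rel_unique[OF G(1)] by blast
    then show ?thesis
      using fls_rel_X[OF G(1)] finite_subset unfolding finitely_many_conjugates_def by blast
  qed
  ultimately have "insert fls_X (fls_const ` M) \<subseteq> {f. finitely_many_conjugates G f}" by blast
  then have "ratfun_field M \<subseteq> {f. finitely_many_conjugates G f}"
    unfolding ratfun_field_def adjoin_def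
    by (intro hull_minimal is_subfield_finitely_many_conjugates G(1))
  then show ?thesis using f by blast
qed

section \<open>Hyperderivatives of multiples of a Laurent series\<close>

text \<open>
  Functions that are polynomial along each line. This weak notion of a polynomial function in
  infinitely many variables suffices for the density arguments and makes products and linear
  substitutions immediate.
\<close>

definition line_poly :: "((nat \<Rightarrow> 'a::field) \<Rightarrow> 'a) \<Rightarrow> bool" where
  "line_poly \<phi> \<longleftrightarrow> (\<forall>u v. \<exists>p. \<forall>z. \<phi> (\<lambda>i. u i + z * v i) = poly p z)"

lemma line_poly_const: "line_poly (\<lambda>w. c)"
  unfolding line_poly_def by (intro allI exI[of _ "[:c:]"]) simp

lemma line_poly_coordinate: "line_poly (\<lambda>w. w i)"
  unfolding line_poly_def
proof (intro allI)
  fix u v :: "nat \<Rightarrow> 'a"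
  show "\<exists>p. \<forall>z. u i + z * v i = poly p z" by (intro exI[of _ "[:u i, v i:]"]) simp
qed

lemma line_poly_add:
  assumes "line_poly \<phi>" "line_poly \<psi>"
  shows "line_poly (\<lambda>w. \<phi> w + \<psi> w)"
  unfolding line_poly_def
proof (intro allI)
  fix u v :: "nat \<Rightarrow> 'a"
  obtain p s where "\<And>z. \<phi> (\<lambda>i. u i + z * v i) = poly p z" "\<And>z. \<psi> (\<lambda>i. u i + z * v i) = poly s z"
    using assms unfolding line_poly_def by blast
  then show "\<exists>p. \<forall>z. \<phi> (\<lambda>i. u i + z * v i) + \<psi> (\<lambda>i. u i + z * v i) = poly p z"
    by (intro exI[of _ "p + s"]) simp
qed

lemma line_poly_mult:
  assumes "line_poly \<phi>" "line_poly \<psi>"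
  shows "line_poly (\<lambda>w. \<phi> w * \<psi> w)"
  unfolding line_poly_def
proof (intro allI)
  fix u v :: "nat \<Rightarrow> 'a"
  obtain p s where "\<And>z. \<phi> (\<lambda>i. u i + z * v i) = poly p z" "\<And>z. \<psi> (\<lambda>i. u i + z * v i) = poly s z"
    using assms unfolding line_poly_def by blast
  then show "\<exists>p. \<forall>z. \<phi> (\<lambda>i. u i + z * v i) * \<psi> (\<lambda>i. u i + z * v i) = poly p z"
    by (intro exI[of _ "p * s"]) simp
qed

lemma line_poly_sum: "(\<And>i. i \<in> I \<Longrightarrow> line_poly (\<phi> i)) \<Longrightarrow> line_poly (\<lambda>w. \<Sum>i\<in>I. \<phi> i w)"
  by (induction I rule: infinite_finite_induct) (auto intro: line_poly_const line_poly_add)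

lemma line_poly_prod: "(\<And>i. i \<in> I \<Longrightarrow> line_poly (\<phi> i)) \<Longrightarrow> line_poly (\<lambda>w. \<Prod>i\<in>I. \<phi> i w)"
  by (induction I rule: infinite_finite_induct) (auto intro: line_poly_const line_poly_mult)

lemma line_poly_power: "line_poly \<phi> \<Longrightarrow> line_poly (\<lambda>w. \<phi> w ^ n)"
  by (induction n) (auto intro: line_poly_const line_poly_mult)

lemma line_poly_finite_zeros:
  assumes "line_poly \<phi>" "\<phi> (\<lambda>i. u i + z * v i) \<noteq> 0"
  shows "finite {z. \<phi> (\<lambda>i. u i + z * v i) = 0}"
proof -
  obtain p where p: "\<And>z. \<phi> (\<lambda>i. u i + z * v i) = poly p z"
    using assms(1) unfolding line_poly_def by blast
  have "p \<noteq> 0" using assms(2) p by auto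
  then show ?thesis unfolding p by (rule poly_roots_finite)
qed

text \<open>
  Join a point where the previous functions do not vanish to one where the new function does not; on
  this line each of them has finitely many zeros.
\<close>

lemma line_poly_common_nonzero:
  fixes \<phi> :: "'i \<Rightarrow> (nat \<Rightarrow> 'a::field) \<Rightarrow> 'a"
  assumes infinite: "infinite (UNIV :: 'a set)" and "finite I"
    and "\<And>i. i \<in> I \<Longrightarrow> line_poly (\<phi> i)" "\<And>i. i \<in> I \<Longrightarrow> \<exists>w. \<phi> i w \<noteq> 0"
  shows "\<exists>w. \<forall>i\<in>I. \<phi> i w \<noteq> 0"
  using assms(2-4)
proof (induction I)
  case (insert i I)
  then obtain u where u: "\<And>j. j \<in> I \<Longrightarrow> \<phi> j u \<noteq> 0" by auto
  obtain v where v: "\<phi> i v \<noteq> 0" using insert.prems by blast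
  let ?l = "\<lambda>z k. u k + z * (v k - u k)"
  have "finite {z. \<phi> j (?l z) = 0}" if "j \<in> insert i I" for j
  proof (cases "j = i")
    case True
    then show ?thesis
      using v insert.prems(1) by (intro line_poly_finite_zeros[of _ _ 1]) auto
  next
    case False
    then show ?thesis
      using u that insert.prems(1) by (intro line_poly_finite_zeros[of _ _ 0]) auto
  qed
  then have "finite (\<Union>j\<in>insert i I. {z. \<phi> j (?l z) = 0})"
    using insert.hyps(1) by blast
  then obtain z where "z \<notin> (\<Union>j\<in>insert i I. {z. \<phi> j (?l z) = 0})"
    using infinite ex_new_if_finite by blast
  then show ?case by (intro exI[of _ "?l z"]) blast
qed simp

text \<open>
  Zariski density of a product of infinite sets: the coordinates are moved into \<open>B\<close> one
  at a time.
\<close>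

lemma line_poly_nonzero_on_box:
  assumes \<phi>: "line_poly \<phi>" "\<phi> w \<noteq> 0" and B: "infinite B"
  shows "\<exists>b. (\<forall>i<n. b i \<in> B) \<and> \<phi> b \<noteq> 0"
proof (induction n)
  case (Suc n)
  then obtain b where b: "\<forall>i<n. b i \<in> B" "\<phi> b \<noteq> 0" by blast
  let ?l = "\<lambda>z i. b i + z * (if i = n then 1 else 0)"
  have "finite {z. \<phi> (?l z) = 0}"
    using b(2) by (intro line_poly_finite_zeros[OF \<phi>(1), of _ 0]) simp
  then have "finite ((\<lambda>z. b n + z) ` {z. \<phi> (?l z) = 0})" by (rule finite_imageI)
  then obtain y where y: "y \<in> B" "y \<notin> (\<lambda>z. b n + z) ` {z. \<phi> (?l z) = 0}"
    using B by (meson finite_subset subsetI)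
  have "\<phi> (?l (y - b n)) \<noteq> 0"
  proof
    assume "\<phi> (?l (y - b n)) = 0"
    then have "b n + (y - b n) \<in> (\<lambda>z. b n + z) ` {z. \<phi> (?l z) = 0}" by blast
    then show False using y(2) by simp
  qed
  moreover have "?l (y - b n) i \<in> B" if "i < Suc n" for i
    using that b(1) y(1) by (cases "i = n") auto
  ultimately show ?case by (intro exI[of _ "?l (y - b n)"]) simp
qed (use \<phi> in auto)

lemma digits_unique:
  fixes f g :: "nat \<Rightarrow> nat"
  assumes "\<And>k. k < n \<Longrightarrow> f k < b" "\<And>k. k < n \<Longrightarrow> g k < b"
    and "(\<Sum>k<n. f k * b ^ k) = (\<Sum>k<n. g k * b ^ k)" and "k < n"
  shows "f k = g k"
  using assms
proof (induction n arbitrary: f g k)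
  case (Suc n)
  have split: "(\<Sum>k<Suc n. h k * b ^ k) = h 0 + b * (\<Sum>k<n. h (Suc k) * b ^ k)" for h
    by (simp only: sum.lessThan_Suc_shift power_Suc sum_distrib_left) (simp add: mult_ac)
  have eq: "f 0 + b * (\<Sum>k<n. f (Suc k) * b ^ k) = g 0 + b * (\<Sum>k<n. g (Suc k) * b ^ k)"
    using Suc.prems(3) unfolding split .
  have small: "f 0 < b" "g 0 < b" using Suc.prems(1,2) by auto
  have "f 0 = (f 0 + b * (\<Sum>k<n. f (Suc k) * b ^ k)) mod b" using small by simp
  also have "\<dots> = g 0" unfolding eq using small by simp
  finally have zero: "f 0 = g 0" .
  then have tail: "(\<Sum>k<n. f (Suc k) * b ^ k) = (\<Sum>k<n. g (Suc k) * b ^ k)"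
    using eq small by simp
  have "f (Suc k) = g (Suc k)" if "k < n" for k
    by (rule Suc.IH[OF _ _ tail that]) (use Suc.prems(1,2) in auto)
  then show ?case using zero Suc.prems(4) by (cases k) auto
qed simp

text \<open>
  Kronecker substitution: with \<open>x k = z ^ (b ^ k)\<close> and \<open>b\<close> larger than all
  exponents, distinct monomials become distinct powers of \<open>z\<close>.
\<close>

lemma polynomial_nonvanishing_point:
  fixes c :: "(nat \<Rightarrow>\<^sub>0 nat) \<Rightarrow> 'a::field"
  assumes infinite: "infinite (UNIV :: 'a set)"
    and M: "finite M" "m0 \<in> M" "c m0 \<noteq> 0"
  shows "\<exists>x. (\<Sum>m\<in>M. c m * (\<Prod>k\<in>Poly_Mapping.keys m. x k ^ Poly_Mapping.lookup m k)) \<noteq> 0"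
proof -
  let ?keys = Poly_Mapping.keys and ?lookup = Poly_Mapping.lookup
  obtain n where "\<forall>k\<in>(\<Union>m\<in>M. ?keys m). k < n"
    using finite_nat_set_iff_bounded[of "\<Union>m\<in>M. ?keys m"] M(1) by auto
  then have n: "k < n" if "m \<in> M" "k \<in> ?keys m" for m k using that by blast
  obtain b where "\<forall>x\<in>(\<Union>m\<in>M. ?lookup m ` {..<n}). x < b"
    using finite_nat_set_iff_bounded[of "\<Union>m\<in>M. ?lookup m ` {..<n}"] M(1) by auto
  then have b: "?lookup m k < b" if "m \<in> M" "k < n" for m k using that by blast
  define e where "e m = (\<Sum>k<n. ?lookup m k * b ^ k)" for m :: "nat \<Rightarrow>\<^sub>0 nat"
  have inj: "inj_on e M"
  proof (rule inj_onI)
    fix m m' assume m: "m \<in> M" "m' \<in> M" "e m = e m'"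
    have "?lookup m k = ?lookup m' k" for k
    proof (cases "k < n")
      case True
      then show ?thesis
        using m b unfolding e_def by (intro digits_unique[of n "?lookup m" b "?lookup m'"]) auto
    next
      case False
      then have "k \<notin> ?keys m" "k \<notin> ?keys m'" using n m by blast+
      then show ?thesis by (simp add: in_keys_iff)
    qed
    then show "m = m'" by (simp add: poly_mapping_eqI)
  qed
  let ?p = "\<Sum>m\<in>M. monom (c m) (e m)"
  have "coeff ?p (e m0) = (\<Sum>m\<in>M. if m = m0 then c m else 0)"
    using inj M(2) by (auto simp: coeff_sum inj_on_eq_iff intro!: sum.cong)
  also have "\<dots> = c m0" using M by (simp add: sum.delta)
  finally have "?p \<noteq> 0" using M(3) by auto
  then have "finite {z. poly ?p z = 0}" by (rule poly_roots_finite)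
  then obtain z where z: "poly ?p z \<noteq> 0"
    using infinite ex_new_if_finite by blast
  have "(\<Prod>k\<in>?keys m. (z ^ (b ^ k)) ^ ?lookup m k) = z ^ e m" if "m \<in> M" for m
  proof -
    have "(\<Prod>k\<in>?keys m. (z ^ (b ^ k)) ^ ?lookup m k) = (\<Prod>k<n. z ^ (?lookup m k * b ^ k))"
      using n[OF that]
      by (intro prod.mono_neutral_cong_left)
        (auto simp: power_mult[symmetric] mult.commute in_keys_iff)
    also have "\<dots> = z ^ e m" unfolding e_def by (simp add: power_sum)
    finally show ?thesis .
  qed
  then have "(\<Sum>m\<in>M. c m * (\<Prod>k\<in>?keys m. (z ^ (b ^ k)) ^ ?lookup m k)) = poly ?p z"
    by (simp add: poly_sum poly_monom)
  then show ?thesis using z by (intro exI[of _ "\<lambda>k. z ^ (b ^ k)"]) simp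
qed

lemma solve_lower_triangular:
  fixes T :: "nat \<Rightarrow> nat \<Rightarrow> 'a::field"
  assumes "\<And>k. T k k \<noteq> 0"
  shows "\<exists>y. \<forall>k<n. (\<Sum>l\<le>k. T k l * y l) = x k"
proof (induction n)
  case (Suc n)
  then obtain y where y: "\<And>k. k < n \<Longrightarrow> (\<Sum>l\<le>k. T k l * y l) = x k" by blast
  let ?y = "y(n := (x n - (\<Sum>l<n. T n l * y l)) / T n n)"
  have "(\<Sum>l\<le>k. T k l * ?y l) = x k" if "k < Suc n" for k
  proof (cases "k = n")
    case True
    have "(\<Sum>l<n. T n l * ?y l) = (\<Sum>l<n. T n l * y l)" by (intro sum.cong) auto
    then show ?thesis using True assms[of n] by (simp add: lessThan_Suc_atMost[symmetric])
  next
    case False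
    then have "(\<Sum>l\<le>k. T k l * ?y l) = (\<Sum>l\<le>k. T k l * y l)"
      using that by (intro sum.cong) auto
    then show ?thesis using y[of k] that False by simp
  qed
  then show ?case by blast
qed simp

lemma solve_upper_triangular:
  fixes U :: "nat \<Rightarrow> nat \<Rightarrow> 'a::field"
  assumes "\<And>k. U k k \<noteq> 0" "\<And>k l. l < k \<Longrightarrow> U k l = 0"
  shows "\<exists>w. \<forall>k<n. (\<Sum>l<n. U k l * w l) = y k"
proof (induction n arbitrary: y)
  case (Suc n)
  let ?c = "y n / U n n"
  obtain w where w: "\<And>k. k < n \<Longrightarrow> (\<Sum>l<n. U k l * w l) = y k - U k n * ?c"
    using Suc.IH[of "\<lambda>k. y k - U k n * ?c"] by blast
  have "(\<Sum>l<Suc n. U k l * (w(n := ?c)) l) = y k" if "k < Suc n" for k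
  proof -
    have "(\<Sum>l<n. U k l * (w(n := ?c)) l) = (\<Sum>l<n. U k l * w l)" by (intro sum.cong) auto
    then show ?thesis using w[of k] assms that by (cases "k = n") auto
  qed
  then show ?case by blast
qed simp

text \<open>
  Vandermonde's identity, transferred from the rational numbers.
\<close>

lemma binom_int_add:
  "binom_int (int i + a) k = (\<Sum>l\<le>k. int (i choose l) * binom_int a (k - l))"
proof -
  have "of_int (binom_int (int i + a) k) = (rat_of_int a + of_nat i) gchoose k"
    by (simp add: of_int_binom_int add.commute)
  also have "\<dots> = (\<Sum>l=0..k. (of_nat i gchoose l) * (rat_of_int a gchoose (k - l)))"
    by (simp add: gbinomial_Vandermonde add.commute)
  also have "\<dots> = of_int (\<Sum>l\<le>k. int (i choose l) * binom_int a (k - l))"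
    by (simp add: atMost_atLeast0 of_int_binom_int binomial_gbinomial)
  finally show ?thesis by (simp only: of_int_eq_iff)
qed

lemma hyperderiv_add: "hyperderiv k (f + g) = hyperderiv k f + hyperderiv k g"
  by (simp add: fls_eq_iff fls_nth_hyperderiv distrib_left)

lemma hyperderiv_sum: "hyperderiv k (\<Sum>i\<in>I. f i) = (\<Sum>i\<in>I. hyperderiv k (f i))"
  by (induction I rule: infinite_finite_induct)
    (simp_all add: hyperderiv_add, simp_all add: fls_eq_iff fls_nth_hyperderiv)

lemma hyperderiv_0: "hyperderiv 0 f = f"
  by (simp add: fls_eq_iff fls_nth_hyperderiv binom_int_def)

lemma fls_nth_of_nat_X_mult:
  "fls_nth (of_nat c * fls_X ^ i * f) j = of_nat c * fls_nth f (j - int i)"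
  by (simp add: mult.assoc fls_X_power_times_conv_shift(1) fls_of_nat)

text \<open>
  The Leibniz rule, in the special case of a power of \<open>t\<close> as first factor.
\<close>

lemma hyperderiv_X_power_mult:
  "hyperderiv k (fls_X ^ i * f)
     = (\<Sum>l\<le>k. of_nat (i choose l) * fls_X ^ (i - l) * hyperderiv (k - l) f)"
proof (rule fls_eqI)
  fix j
  have coefficient: "fls_nth (of_nat (i choose l) * fls_X ^ (i - l) * hyperderiv (k - l) f) j
      = of_int (int (i choose l) * binom_int (j + int k - int i) (k - l))
          * fls_nth f (j + int k - int i)" if "l \<le> k" for l
  proof (cases "l \<le> i")
    case True
    then have eq: "j - int (i - l) + int (k - l) = j + int k - int i"
      using that by (simp add: of_nat_diff)
    show ?thesis
      unfolding fls_nth_of_nat_X_mult fls_nth_hyperderiv eq by (simp add: mult.assoc)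
  qed (simp add: binomial_eq_0)
  have "fls_nth (hyperderiv k (fls_X ^ i * f)) j
      = of_int (binom_int (int i + (j + int k - int i)) k) * fls_nth f (j + int k - int i)"
    by (simp add: fls_nth_hyperderiv fls_X_power_times_conv_shift)
  also have "\<dots> = (\<Sum>l\<le>k. fls_nth (of_nat (i choose l) * fls_X ^ (i - l) * hyperderiv (k - l) f) j)"
    unfolding binom_int_add of_int_sum sum_distrib_right by (intro sum.cong) (simp_all add: coefficient)
  also have "\<dots> = fls_nth (\<Sum>l\<le>k. of_nat (i choose l) * fls_X ^ (i - l) * hyperderiv (k - l) f) j"
    by (simp add: fls_nth_sum)
  finally show "fls_nth (hyperderiv k (fls_X ^ i * f)) j = \<dots>" .
qed

text \<open>
  From \<open>l * (N choose l) = N * (N - 1 choose l - 1)\<close>, the factor \<open>l\<close> being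
  absorbed by \<open>fact n\<close>.
\<close>

lemma choose_eq_0_in_characteristic:
  assumes p: "of_nat p = (0 :: 'a::field)" and N: "p * fact n dvd N" and l: "0 < l" "l \<le> n"
  shows "of_nat (N choose l) = (0 :: 'a)"
proof -
  have "l dvd fact n" using l by (intro dvd_fact) auto
  then obtain d where d: "fact n = l * d" by blast
  obtain e where e: "N = p * fact n * e" using N by blast
  show ?thesis
  proof (cases N)
    case (Suc M)
    have "l * (N choose l) = N * (M choose (l - 1))"
      using Suc_times_binomial_eq[of M "l - 1"] Suc l by simp
    also have "\<dots> = l * (p * (d * e * (M choose (l - 1))))"
      unfolding e d by (simp add: mult_ac)
    finally have "N choose l = p * (d * e * (M choose (l - 1)))" using l(1) by simp
    then show ?thesis using p by simp
  qed (use l in \<open>simp add: binomial_eq_0\<close>)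
qed

text \<open>
  Multiplication by \<open>t ^ N\<close> commutes with the first hyperderivatives if \<open>N\<close>
  is sufficiently divisible. This provides infinitely many multipliers that behave as constants.
\<close>

lemma hyperderiv_linear:
  fixes f :: "'a::field fls"
  assumes p: "of_nat p = (0 :: 'a)" and N: "p * fact n dvd N" and k: "k \<le> n"
  shows "hyperderiv k ((1 + fls_X ^ N) * f) = (1 + fls_X ^ N) * hyperderiv k f"
proof -
  have "of_nat (N choose l) = (0 :: 'a fls)" if "0 < l" "l \<le> k" for l
    using choose_eq_0_in_characteristic[OF p N, of l] that k by (simp add: fls_of_nat)
  then have "hyperderiv k (fls_X ^ N * f)
      = (\<Sum>l\<le>k. if l = 0 then fls_X ^ N * hyperderiv k f else 0)"
    unfolding hyperderiv_X_power_mult by (intro sum.cong) auto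
  also have "\<dots> = fls_X ^ N * hyperderiv k f" by simp
  finally show ?thesis by (simp add: distrib_right hyperderiv_add)
qed

text \<open>
  By the Leibniz rule the matrix is the product of the lower triangular matrix of the
  \<open>hyperderiv (k - l) f\<close>, with \<open>f\<close> on the diagonal, and the upper
  unitriangular matrix of the hyperderivatives of \<open>t ^ i\<close>.
\<close>

lemma hyperderiv_matrix_surjective:
  fixes f :: "'a::field fls"
  assumes f: "f \<noteq> 0"
  shows "\<exists>w. \<forall>k<n. (\<Sum>i<n. w i * hyperderiv k (fls_X ^ i * f)) = x k"
proof -
  obtain y where y: "\<And>k. k < n \<Longrightarrow> (\<Sum>l\<le>k. hyperderiv (k - l) f * y l) = x k"
    using solve_lower_triangular[of "\<lambda>k l. hyperderiv (k - l) f" n x] f by (auto simp: hyperderiv_0)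
  let ?U = "\<lambda>l i. of_nat (i choose l) * fls_X ^ (i - l) :: 'a fls"
  obtain w where w: "\<And>l. l < n \<Longrightarrow> (\<Sum>i<n. ?U l i * w i) = y l"
    using solve_upper_triangular[of ?U n y] by (auto simp: binomial_eq_0)
  have "(\<Sum>i<n. w i * hyperderiv k (fls_X ^ i * f)) = x k" if k: "k < n" for k
  proof -
    have "(\<Sum>i<n. w i * hyperderiv k (fls_X ^ i * f))
        = (\<Sum>i<n. \<Sum>l\<le>k. hyperderiv (k - l) f * (?U l i * w i))"
      unfolding hyperderiv_X_power_mult sum_distrib_left by (simp add: mult_ac)
    also have "\<dots> = (\<Sum>l\<le>k. hyperderiv (k - l) f * (\<Sum>i<n. ?U l i * w i))"
      unfolding sum_distrib_left by (rule sum.swap)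
    also have "\<dots> = (\<Sum>l\<le>k. hyperderiv (k - l) f * y l)"
      using k w by (intro sum.cong) auto
    finally show ?thesis using y[OF k] by simp
  qed
  then show ?thesis by blast
qed

text \<open>
  For multipliers \<open>a = (\<Sum>i<n. b i * t ^ i)\<close> with \<open>b i\<close> acting as
  constants, the derivatives of \<open>a * f\<close> of order less than \<open>n\<close> are an
  invertible linear image of the tuple \<open>b\<close>. The \<open>b i\<close> range independently
  over an infinite set, so they can be chosen outside of the zero sets of finitely many nonzero
  polynomials.
\<close>

lemma multiplier_avoiding_relations:
  fixes f :: "'a::field fls" and \<Phi> :: "((nat \<Rightarrow>\<^sub>0 nat) \<Rightarrow> 'a fls) set"
  assumes p: "p > 0" "of_nat p = (0 :: 'a)" and f: "f \<noteq> 0"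
    and M: "finite M" "\<forall>m\<in>M. Poly_Mapping.keys m \<subseteq> {..<n}"
    and \<Phi>: "finite \<Phi>" "\<forall>c\<in>\<Phi>. \<exists>m\<in>M. c m \<noteq> 0"
  shows "\<exists>e. (\<forall>i. e i > 0) \<and> (\<forall>c\<in>\<Phi>. (\<Sum>m\<in>M. c m * (\<Prod>k\<in>Poly_Mapping.keys m.
    hyperderiv k ((\<Sum>i<n. fls_X ^ i * (1 + fls_X ^ e i)) * f) ^ Poly_Mapping.lookup m k)) \<noteq> 0)"
proof -
  let ?keys = Poly_Mapping.keys and ?lookup = Poly_Mapping.lookup
  define N where "N i = p * fact n * Suc i" for i :: nat
  define B where "B = range (\<lambda>i. 1 + fls_X ^ N i :: 'a fls)"
  have "inj (\<lambda>i. 1 + fls_X ^ N i :: 'a fls)"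
  proof (rule injI)
    fix i j assume "1 + fls_X ^ N i = (1 + fls_X ^ N j :: 'a fls)"
    then have "fls_nth (fls_X ^ N i :: 'a fls) (int (N i)) = fls_nth (fls_X ^ N j) (int (N i))" by simp
    then have "N i = N j" by (simp split: if_splits)
    then show "i = j" using p(1) by (simp add: N_def)
  qed
  then have B: "infinite B" unfolding B_def by (rule range_inj_infinite)
  then have UNIV: "infinite (UNIV :: 'a fls set)" using finite_subset[OF subset_UNIV] by blast
  \<comment> \<open>the relation \<open>c\<close> in the derivatives of \<open>(\<Sum>i<n. w i * X ^ i) * f\<close>, with the \<open>w i\<close> treated as
    constants for the hyperderivatives\<close>
  define \<phi> where "\<phi> c w = (\<Sum>m\<in>M. c m * (\<Prod>k\<in>?keys m.
      (\<Sum>i<n. w i * hyperderiv k (fls_X ^ i * f)) ^ ?lookup m k))" for c w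
  have line: "line_poly (\<phi> c)" for c
    unfolding \<phi>_def
    by (intro line_poly_sum line_poly_mult line_poly_const line_poly_prod line_poly_power
        line_poly_coordinate)
  have "\<exists>w. \<phi> c w \<noteq> 0" if c: "c \<in> \<Phi>" for c
  proof -
    obtain m0 where "m0 \<in> M" "c m0 \<noteq> 0" using \<Phi>(2) c by blast
    then obtain x where x: "(\<Sum>m\<in>M. c m * (\<Prod>k\<in>?keys m. x k ^ ?lookup m k)) \<noteq> 0"
      using polynomial_nonvanishing_point[OF UNIV M(1), of m0 c] by blast
    obtain w where w: "\<And>k. k < n \<Longrightarrow> (\<Sum>i<n. w i * hyperderiv k (fls_X ^ i * f)) = x k"
      using hyperderiv_matrix_surjective[OF f] by blast
    have "\<phi> c w = (\<Sum>m\<in>M. c m * (\<Prod>k\<in>?keys m. x k ^ ?lookup m k))"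
      unfolding \<phi>_def using M(2) w
      by (intro sum.cong arg_cong2[of _ _ _ _ "(*)"] prod.cong arg_cong2[of _ _ _ _ "(^)"]) auto
    then show ?thesis using x by (intro exI[of _ w]) simp
  qed
  then obtain w where "\<forall>c\<in>\<Phi>. \<phi> c w \<noteq> 0"
    using line_poly_common_nonzero[OF UNIV \<Phi>(1), of \<phi>] line by blast
  then have "(\<Prod>c\<in>\<Phi>. \<phi> c w) \<noteq> 0" using \<Phi>(1) by simp
  then obtain b where b: "\<forall>i<n. b i \<in> B" "(\<Prod>c\<in>\<Phi>. \<phi> c b) \<noteq> 0"
    using line_poly_nonzero_on_box[OF line_poly_prod[of \<Phi> \<phi>, OF line] _ B] by blast
  have "\<forall>i. \<exists>j. i < n \<longrightarrow> b i = 1 + fls_X ^ N j"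
    using b(1) unfolding B_def by blast
  then obtain e where e: "\<And>i. i < n \<Longrightarrow> b i = 1 + fls_X ^ N (e i)"
    using choice[of "\<lambda>i j. i < n \<longrightarrow> b i = 1 + fls_X ^ N j"] by blast
  let ?a = "\<Sum>i<n. fls_X ^ i * (1 + fls_X ^ N (e i)) :: 'a fls"
  have a: "?a = (\<Sum>i<n. b i * fls_X ^ i)" using e by (simp add: mult.commute)
  have derivatives: "hyperderiv k (?a * f) = (\<Sum>i<n. b i * hyperderiv k (fls_X ^ i * f))"
    if "k < n" for k
  proof -
    have "hyperderiv k (b i * (fls_X ^ i * f)) = b i * hyperderiv k (fls_X ^ i * f)" if "i < n" for i
      unfolding e[OF that] using \<open>k < n\<close>
      by (intro hyperderiv_linear[OF p(2), of n]) (auto simp: N_def)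
    then show ?thesis
      unfolding a by (simp add: sum_distrib_right hyperderiv_sum mult.assoc)
  qed
  have "(\<Sum>m\<in>M. c m * (\<Prod>k\<in>?keys m. hyperderiv k (?a * f) ^ ?lookup m k)) \<noteq> 0"
    if c: "c \<in> \<Phi>" for c
  proof -
    have "(\<Sum>m\<in>M. c m * (\<Prod>k\<in>?keys m. hyperderiv k (?a * f) ^ ?lookup m k)) = \<phi> c b"
      unfolding \<phi>_def using M(2) derivatives
      by (intro sum.cong arg_cong2[of _ _ _ _ "(*)"] prod.cong arg_cong2[of _ _ _ _ "(^)"]) auto
    then show ?thesis using b(2) c \<Phi>(1) by auto
  qed
  moreover have "N i > 0" for i using p(1) by (simp add: N_def)
  ultimately show ?thesis by (intro exI[of _ "\<lambda>i. N (e i)"]) blast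
qed

section \<open>Hypertranscendence\<close>

context carlitz
begin

lemma torsion_sequence_of_twist:
  assumes W: "twist W = W * (fps_X - fps_const \<theta>)" and W0: "fps_nth W 0 ^ (card F - 1) = - \<theta>"
  shows "torsion_sequence (fps_nth W)"
  unfolding torsion_sequence_def
proof (intro conjI allI W0)
  fix n
  have "fps_nth W (Suc n) ^ card F = fps_nth W n - \<theta> * fps_nth W (Suc n)"
    using W[THEN arg_cong[of _ _ "\<lambda>f. fps_nth f (Suc n)"]]
    by (simp add: twist_def right_diff_distrib mult.commute)
  then show "fps_nth W (Suc n) ^ card F + \<theta> * fps_nth W (Suc n) = fps_nth W n" by simp
qed

lemma torsion_sequence_in_algebraically_closed:
  assumes L: "is_subfield L" "\<theta> \<in> L"
    and closed: "\<forall>p. degree p > 0 \<and> (\<forall>i. coeff p i \<in> L) \<longrightarrow> (\<exists>x\<in>L. poly p x = 0)"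
    and w: "torsion_sequence w"
  shows "w n \<in> L"
proof -
  note root = root_in_algebraically_closed_subfield[OF L(1) closed]
  have r: "partial_hom (Id_on L)" using L(1) by (rule partial_hom_Id_on)
  have rel: "coeff p i \<in> L" if "polrel (Id_on L) p p" for p i
    using that by (auto simp: polrel_def)
  have q: "card F - 1 > 0" "card F > 1" using card_ge_2 by simp_all
  show ?thesis
  proof (induction n)
    case 0
    let ?f = "monom 1 (card F - 1) + [:\<theta>:]"
    have f: "polrel (Id_on L) ?f ?f"
      using L(2) by (intro polrel_add[OF r] polrel_monom[OF r] polrel_const[OF r] partial_hom_one[OF r]) auto
    have "degree ?f = card F - 1"
      using q by (subst degree_add_eq_left) (simp_all add: degree_monom_eq)
    then have nonzero: "?f \<noteq> 0" using q by auto
    have "poly ?f (w 0) = 0" using w by (simp add: poly_monom torsion_sequence_def)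
    then show ?case by (rule root[OF nonzero rel[OF f]])
  next
    case (Suc n)
    let ?f = "monom 1 (card F) + (monom \<theta> 1 - [:w n:])"
    have f: "polrel (Id_on L) ?f ?f"
      using L(2) Suc by (intro polrel_add[OF r] polrel_diff[OF r] polrel_monom[OF r]
          polrel_const[OF r] partial_hom_one[OF r]) auto
    have "degree (monom \<theta> 1 - [:w n:]) \<le> 1"
      by (intro degree_diff_le) (simp_all add: degree_monom_le)
    then have "degree ?f = card F"
      using q by (subst degree_add_eq_left) (simp_all add: degree_monom_eq)
    then have nonzero: "?f \<noteq> 0" using q by auto
    have "poly ?f (w (Suc n)) = 0"
      using w by (simp add: poly_monom torsion_sequence_def add_diff_eq)
    then show ?case by (rule root[OF nonzero rel[OF f]])
  qed
qed

text \<open>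
  If \<open>P\<close> were a relation, then for each multiplier \<open>a\<close> over the prime field
  with constant coefficient \<open>1\<close> the homomorphism taking the coefficients of
  \<open>W\<close> to those of \<open>a * W\<close> extends to \<open>K_bar\<close> and turns
  \<open>P\<close> into one of finitely many nonzero conjugate relations, satisfied by the derivatives
  of \<open>a * W\<close>. Some \<open>a\<close> avoids all of them.
\<close>

lemma hyperderiv_alg_independent:
  assumes L: "is_algebraic_closure (K_inf F \<theta>) L"
    and W: "twist W = W * (fps_X - fps_const \<theta>)" "fps_nth W 0 ^ (card F - 1) = - \<theta>"
  shows "alg_independent (ratfun_field (K_bar F \<theta>)) (\<lambda>n. hyperderiv n (fps_to_fls W))"
  unfolding alg_independent_def
proof (intro allI impI)
  fix P :: "(nat \<Rightarrow>\<^sub>0 nat) \<Rightarrow>\<^sub>0 'c fls"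
  let ?f = "fps_to_fls W" and ?keys = Poly_Mapping.keys and ?lookup = Poly_Mapping.lookup
  assume "(\<forall>m. ?lookup P m \<in> ratfun_field (K_bar F \<theta>)) \<and> mpoly_value (\<lambda>n. hyperderiv n ?f) P = 0"
  then have coefficients: "?lookup P m \<in> ratfun_field (K_bar F \<theta>)"
    and relation: "mpoly_value (\<lambda>n. hyperderiv n ?f) P = 0" for m by simp_all
  show "P = 0"
  proof (rule ccontr)
    assume "P \<noteq> 0"
    then have "?keys P \<noteq> {}" by simp
    then obtain m0 where m0: "m0 \<in> ?keys P" by blast
    let ?K = "rat_K F \<theta>"
    have L': "is_subfield L" "K_inf F \<theta> \<subseteq> L"
      and closed: "\<forall>p. degree p > 0 \<and> (\<forall>i. coeff p i \<in> L) \<longrightarrow> (\<exists>x\<in>L. poly p x = 0)"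
      using L by (auto simp: is_algebraic_closure_def)
    have KL: "?K \<subseteq> L" using L'(2) closure_subset[of ?K] by (auto simp: K_inf_def)
    have theta: "\<theta> \<in> ?K" unfolding rat_K_def adjoin_def by (rule hull_inc) simp
    define G where "G = {r. partial_hom r \<and> Id_on ?K \<subseteq> r \<and> K_bar F \<theta> \<subseteq> Domain r}"
    have G: "partial_hom r" "Id_on ?K \<subseteq> r" "K_bar F \<theta> \<subseteq> Domain r" if "r \<in> G" for r
      using that by (simp_all add: G_def)
    have conjugates: "finitely_many_conjugates G (?lookup P m)" for m
      using G coefficients
      by (intro ratfun_finitely_many_conjugates[of G ?K "K_bar F \<theta>"]) (auto simp: K_bar_def)
    obtain n' where "\<forall>k\<in>(\<Union>m\<in>?keys P. ?keys m). k < n'"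
      using finite_nat_set_iff_bounded[of "\<Union>m\<in>?keys P. ?keys m"] by auto
    then have "\<forall>m\<in>?keys P. ?keys m \<subseteq> {..<Suc n'}" by (auto intro: less_SucI)
    \<comment> \<open>\<open>n > 0\<close> makes the constant coefficient of the multiplier \<open>a\<close> below equal to \<open>1\<close>\<close>
    then obtain n where n: "n > 0" "\<forall>m\<in>?keys P. ?keys m \<subseteq> {..<n}" by blast
    obtain p where p: "p > 0" "of_nat p = (0 :: 'c)" using positive_characteristic by blast
    \<comment> \<open>the finitely many relations that can arise from \<open>P\<close>, as families of coefficients\<close>
    define \<Phi> where "\<Phi> = {c \<in> PiE (?keys P) (\<lambda>m. {g. \<exists>r\<in>G. fls_rel r (?lookup P m) g}).
        \<forall>m\<in>?keys P. c m \<noteq> 0}"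
    have "finite (PiE (?keys P) (\<lambda>m. {g. \<exists>r\<in>G. fls_rel r (?lookup P m) g}))"
      using conjugates unfolding finitely_many_conjugates_def by (intro finite_PiE) simp_all
    then have "finite \<Phi>" unfolding \<Phi>_def by simp
    have nonzero: "\<forall>c\<in>\<Phi>. \<exists>m\<in>?keys P. c m \<noteq> 0"
      using m0 by (auto simp: \<Phi>_def)
    have f0: "?f \<noteq> 0"
      using W(2) theta_nonzero card_ge_2 by (auto simp: zero_power)
    obtain e where e: "\<forall>i. e i > 0" "\<forall>c\<in>\<Phi>. (\<Sum>m\<in>?keys P. c m * (\<Prod>k\<in>?keys m.
        hyperderiv k ((\<Sum>i<n. fls_X ^ i * (1 + fls_X ^ e i)) * ?f) ^ ?lookup m k)) \<noteq> 0"
      using multiplier_avoiding_relations[OF p f0 finite_keys n(2) \<open>finite \<Phi>\<close> nonzero]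
      by (elim exE conjE)
    define a where "a = (\<Sum>i<n. fps_X ^ i * (1 + fps_X ^ e i) :: 'c fps)"
    have aW_fls: "fps_to_fls (a * W) = (\<Sum>i<n. fls_X ^ i * (1 + fls_X ^ e i)) * ?f"
    proof -
      have "fps_to_fls (\<Sum>i\<in>I. h i) = (\<Sum>i\<in>I. fps_to_fls (h i))" for h :: "nat \<Rightarrow> 'c fps" and I
        by (induction I rule: infinite_finite_induct) simp_all
      then show ?thesis by (simp add: a_def fls_times_fps_to_fls fps_to_fls_power)
    qed
    have a0: "fps_nth a 0 = 1"
    proof -
      have "fps_nth a 0 = (\<Sum>i<n. fps_nth (fps_X ^ i * (1 + fps_X ^ e i) :: 'c fps) 0)"
        by (simp only: a_def fps_sum_nth)
      also have "\<dots> = (\<Sum>i<n. if i = 0 then 1 else 0)"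
        using e(1) by (intro sum.cong) auto
      also have "\<dots> = 1" using n(1) by simp
      finally show ?thesis .
    qed
    have aW: "twist (a * W) = a * W * (fps_X - fps_const \<theta>)"
    proof -
      have "twist a = a"
        by (simp add: a_def twist_sum twist_mult twist_add twist_power twist_X twist_one)
      then show ?thesis by (simp add: twist_mult W(1) mult.assoc)
    qed
    have tW: "torsion_sequence (fps_nth W)"
      using W by (rule torsion_sequence_of_twist)
    have taW: "torsion_sequence (fps_nth (a * W))"
      using aW W(2) a0 by (intro torsion_sequence_of_twist) simp_all
    have in_L: "range (fps_nth V) \<subseteq> L" if "torsion_sequence (fps_nth V)" for V
      using torsion_sequence_in_algebraically_closed[OF L'(1) _ closed that] KL theta by blast
    obtain r0 where r0: "partial_hom r0" "Id_on ?K \<subseteq> r0" "r0 \<subseteq> L \<times> L"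
      "\<And>j. (fps_nth W j, fps_nth (a * W) j) \<in> r0"
      using torsion_partial_hom[OF tW taW L'(1) KL in_L[OF tW] in_L[OF taW]] by blast
    obtain r where r: "partial_hom r" "r0 \<subseteq> r" "\<forall>x. algebraic_over ?K x \<longrightarrow> x \<in> Domain r"
      using partial_hom_extend_algebraic[OF L'(1) closed r0(1,3,2)] by blast
    have rG: "r \<in> G" using r r0(2) by (auto simp: G_def K_bar_def)
    have rel: "fls_rel r ?f (fps_to_fls (a * W))"
      using r(2) r0(4) partial_hom_zero[OF r(1)] by (auto simp: fls_rel_def)
    have "\<forall>m. \<exists>g. fls_rel r (?lookup P m) g"
      using conjugates rG unfolding finitely_many_conjugates_def by blast
    then obtain c' where c': "\<And>m. fls_rel r (?lookup P m) (c' m)"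
      using choice[of "\<lambda>m. fls_rel r (?lookup P m)"] by blast
    define c where "c = restrict c' (?keys P)"
    have c: "fls_rel r (?lookup P m) (c m)" if "m \<in> ?keys P" for m
      using c' that by (simp add: c_def)
    have "c m \<noteq> 0" if "m \<in> ?keys P" for m
      using fls_rel_eq_0_iff[OF r(1) c[OF that]] that by (simp add: in_keys_iff)
    then have "c \<in> \<Phi>"
      using c rG unfolding \<Phi>_def c_def by (auto intro!: restrict_PiE)
    have "fls_rel r (mpoly_value (\<lambda>n. hyperderiv n ?f) P) (\<Sum>m\<in>?keys P. c m *
        (\<Prod>k\<in>?keys m. hyperderiv k (fps_to_fls (a * W)) ^ ?lookup m k))"
      unfolding mpoly_value_def
      by (intro fls_rel_sum fls_rel_mult fls_rel_prod fls_rel_power fls_rel_hyperderiv rel c r(1))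
    then have "fls_rel r 0 (\<Sum>m\<in>?keys P. c m *
        (\<Prod>k\<in>?keys m. hyperderiv k (fps_to_fls (a * W)) ^ ?lookup m k))"
      by (simp only: relation)
    then show False
      using fls_rel_eq_0_iff[OF r(1), of 0] bspec[OF e(2) \<open>c \<in> \<Phi>\<close>] by (simp add: aW_fls)
  qed
qed

end

theorem theorem1p3:
  fixes Fq :: "'c::{nonarch_valued_field, complete_space} set"
    and \<theta> lam :: 'c
  assumes "is_C_inf Fq \<theta>"
    and "lam \<in> K_bar Fq \<theta>"
    and "lam ^ (card Fq - 1) = - \<theta>"
  shows "alg_independent (ratfun_field (K_bar Fq \<theta>))
           (\<lambda>n. hyperderiv n (anderson_thakur (card Fq) \<theta> lam))"
proof -
  interpret carlitz Fq \<theta>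
    using assms(1) by unfold_locales (simp_all add: is_C_inf_def)
  obtain L where "is_algebraic_closure (K_inf Fq \<theta>) L"
    using assms(1) by (auto simp: is_C_inf_def)
  moreover obtain W where "anderson_thakur (card Fq) \<theta> lam = fps_to_fls W" "fps_nth W 0 = lam"
    "twist W = W * (fps_X - fps_const \<theta>)"
    using anderson_thakur_coefficients[OF assms(3)] by blast
  ultimately show ?thesis
    using hyperderiv_alg_independent[of L W] assms(3) by simp
qed

end
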